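(* Let $\mathbf{Y}\in\mathbb{R}^{p\times r}_*$ and set $r_{\mathbf{Y}}:=\sigma_r(\mathbf{Y})/3$. For every $0<x\le r_{\mathbf{Y}}$, the geodesic ball $B_x([\mathbf{Y}])=\{[\mathbf{Y}_1]\in\mathcal{M}: d([\mathbf{Y}_1],[\mathbf{Y}])<x\}$ is geodesically convex. In fact, for any two points $[\mathbf{Y}_1],[\mathbf{Y}_2]\in B_x([\mathbf{Y}])$ there is a unique shortest geodesic of $\mathcal{M}$ joining them, and it is entirely contained in $B_x([\mathbf{Y}])$.
   Context: Let $0<r\le p$ be integers. $\mathbb{R}^{p\times r}_*$ is the set of real $p\times r$ matrices of full column rank, $\mathbb{O}_r$ is the group of $r\times r$ orthogonal matrices, $\|\cdot\|_F$ is the Frobenius norm, and $\sigma_i(\cdot)$ is the $i$-th largest singular value. $\mathcal{M}:=\mathbb{R}^{p\times r}_*/\mathbb{O}_r$ is the quotient manifold whose points are the classes $[\mathbf{Y}]=\{\mathbf{Y}\mathbf{O}:\mathbf{O}\in\mathbb{O}_r\}$. It carries the Riemannian metric induced from the Euclidean metric $\bar g_{\mathbf{Y}}(\eta,\theta)=\mathrm{tr}(\eta^\top\theta)$ on $\mathbb{R}^{p\times r}_*$: the vertical space at $\mathbf{Y}$ is $\{\mathbf{Y}\boldsymbol{\Omega}:\boldsymbol{\Omega}^\top=-\boldsymbol{\Omega}\}$, the horizontal space is its orthogonal complement $\mathcal{H}_{\mathbf{Y}}=\{\theta\in\mathbb{R}^{p\times r}:\mathbf{Y}^\top\theta\text{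 is symmetric}\}$, and the inner product of two tangent vectors at $[\mathbf{Y}]$ is the Euclidean inner product of their horizontal lifts at $\mathbf{Y}$. The geodesic distance on $\mathcal{M}$ is $d([\mathbf{Y}_1],[\mathbf{Y}_2])=\min_{\mathbf{Q}\in\mathbb{O}_r}\|\mathbf{Y}_2\mathbf{Q}-\mathbf{Y}_1\|_F$. A subset of $\mathcal{M}$ is geodesically convex if any two of its points can be connected by a geodesic completely contained in the subset. *)

theory Defs
  imports "HOL-Analysis.Analysis" "HOL-Library.Multiset"
begin

text \<open>
  A real \<open>p \<times> r\<close> matrix has type \<open>real^'r^'p\<close>.  On this type the library's \<open>norm\<close> is the Frobenius
  norm and the library's inner product is \<open>tr(\<eta>\<^sup>T \<theta>)\<close>; the latter is the following lemma.
\<close>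

lemma inner_matrix_eq_trace:
  fixes A B :: "real^'r^'p"
  shows "A \<bullet> B = trace (transpose A ** B)"
  unfolding inner_vec_def trace_def transpose_def matrix_matrix_mult_def
  by (simp add: sum.swap[of _ "UNIV :: 'r set"])

subsection \<open>Singular values\<close>

definition gram_eigenspace :: "real^'r^'p \<Rightarrow> real \<Rightarrow> (real^'r) set" where
  "gram_eigenspace A s = {v. (transpose A ** A) *v v = s\<^sup>2 *\<^sub>R v}"

text \<open>
  With multiplicity.  For \<open>r \<le> p\<close>, the only case needed here, there are exactly \<open>r\<close> of them.
\<close>

definition singular_values :: "real^'r^'p \<Rightarrow> real multiset" where
  "singular_values A =
     (\<Sum>s | 0 \<le> s \<and> gram_eigenspace A s \<noteq> {0}. replicate_mset (dim (gram_eigenspace A s)) s)"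

text \<open>The \<open>i\<close>-th largest singular value, counting from \<open>i = 1\<close>.\<close>

definition sing_val :: "nat \<Rightarrow> real^'r^'p \<Rightarrow> real" where
  "sing_val i A = rev (sorted_list_of_multiset (singular_values A)) ! (i - 1)"

subsection \<open>The quotient of the full column rank matrices by the orthogonal group\<close>

definition full_col_rank :: "(real^'r^'p) set" where
  "full_col_rank = {Y. rank Y = CARD('r)}"

definition orbit_class :: "real^'r^'p \<Rightarrow> (real^'r^'p) set" where
  "orbit_class Y = {Y ** Q | Q. orthogonal_matrix Q}"

definition quot_manifold :: "(real^'r^'p) set set" where
  "quot_manifold = orbit_class ` full_col_rank"

text \<open>
  The value does not depend on the two representatives, and the infimum is attained because the
  orthogonal group is compact.
\<close>

definition geo_dist :: "(real^'r^'p) set \<Rightarrow> (real^'r^'p) set \<Rightarrow> real" where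
  "geo_dist P1 P2 =
     (let Y1 = (SOME Y. Y \<in> P1); Y2 = (SOME Y. Y \<in> P2)
      in INF Q \<in> {Q. orthogonal_matrix Q}. norm (Y2 ** Q - Y1))"

definition geo_ball :: "real \<Rightarrow> (real^'r^'p) set \<Rightarrow> (real^'r^'p) set set" where
  "geo_ball x P = {P1 \<in> quot_manifold. geo_dist P1 P < x}"

subsection \<open>The Riemannian metric\<close>

definition vertical_space :: "real^'r^'p \<Rightarrow> (real^'r^'p) set" where
  "vertical_space Y = {Y ** W | W. transpose W = - W}"

definition horizontal_space :: "real^'r^'p \<Rightarrow> (real^'r^'p) set" where
  "horizontal_space Y = (vertical_space Y)\<^sup>\<bottom>"

lemma horizontal_space_eq:
  fixes Y :: "real^'r^'p"
  shows "horizontal_space Y = {\<theta>. transpose (transpose Y ** \<theta>) = transpose Y ** \<theta>}"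
proof -
  have key: "(Y ** W) \<bullet> \<theta> = W \<bullet> (transpose Y ** \<theta>)" for W :: "real^'r^'r" and \<theta>
    by (simp add: inner_matrix_eq_trace matrix_transpose_mul matrix_mul_assoc)
  have tr: "transpose A \<bullet> transpose B = A \<bullet> B" for A B :: "real^'r^'r"
    unfolding inner_vec_def transpose_def by (simp, rule sum.swap)
  have "\<theta> \<in> horizontal_space Y \<longleftrightarrow> transpose (transpose Y ** \<theta>) = transpose Y ** \<theta>" for \<theta>
  proof -
    let ?S = "transpose Y ** \<theta>"
    have "\<theta> \<in> horizontal_space Y \<longleftrightarrow> (\<forall>W. transpose W = - W \<longrightarrow> W \<bullet> ?S = 0)"
      by (auto simp: horizontal_space_def vertical_space_def orthogonal_comp_def orthogonal_def key)
    also have "\<dots> \<longleftrightarrow> transpose ?S = ?S"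
    proof
      let ?W = "?S - transpose ?S"
      assume h: "\<forall>W. transpose W = - W \<longrightarrow> W \<bullet> ?S = 0"
      have sk: "transpose ?W = - ?W" by (simp add: transpose_def vec_eq_iff)
      then have "?W \<bullet> ?S = 0" using h by blast
      moreover have "?W \<bullet> transpose ?S = - (?W \<bullet> ?S)"
        using tr[of ?W "?S"] unfolding sk inner_minus_left by linarith
      ultimately have "?W \<bullet> ?W = 0" by (simp add: inner_diff_right)
      then show "transpose ?S = ?S" by simp
    next
      assume s: "transpose ?S = ?S"
      show "\<forall>W. transpose W = - W \<longrightarrow> W \<bullet> ?S = 0"
      proof (intro allI impI)
        fix W :: "real^'r^'r" assume "transpose W = - W"
        then show "W \<bullet> ?S = 0" using tr[of W ?S] s by simp
      qed
    qed
    finally show ?thesis .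
  qed
  then show ?thesis by blast
qed

text \<open>
  A matrix \<open>\<theta>\<close> represents at \<open>Y\<close> the tangent vector of the quotient at the class of \<open>Y\<close> that is the
  image of \<open>\<theta>\<close> under the differential of the projection.  The horizontal lift at \<open>Y\<close> of that tangent
  vector is the horizontal component of \<open>\<theta>\<close>.
\<close>

definition horizontal_lift :: "real^'r^'p \<Rightarrow> real^'r^'p \<Rightarrow> real^'r^'p" where
  "horizontal_lift Y \<theta> = (THE \<xi>. \<xi> \<in> horizontal_space Y \<and> \<theta> - \<xi> \<in> vertical_space Y)"

definition quot_metric :: "real^'r^'p \<Rightarrow> real^'r^'p \<Rightarrow> real^'r^'p \<Rightarrow> real" where
  "quot_metric Y \<eta> \<theta> = horizontal_lift Y \<eta> \<bullet> horizontal_lift Y \<theta>"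

subsection \<open>Curves, length and geodesics\<close>

text \<open>
  The projection onto the quotient is a principal bundle, so the \<open>C\<^sup>1\<close> curves of the quotient on a
  compact interval are exactly the projections of \<open>C\<^sup>1\<close> curves of full column rank matrices.  The
  values of \<open>\<gamma>\<close> outside \<open>{a..b}\<close> are irrelevant.
\<close>

definition C1_lift :: "(real \<Rightarrow> real^'r^'p) \<Rightarrow> (real \<Rightarrow> (real^'r^'p) set) \<Rightarrow> real \<Rightarrow> real \<Rightarrow> bool" where
  "C1_lift c \<gamma> a b \<longleftrightarrow> c C1_differentiable_on {a..b} \<and>
     (\<forall>t\<in>{a..b}. c t \<in> full_col_rank \<and> \<gamma> t = orbit_class (c t))"

definition C1_curve :: "(real \<Rightarrow> (real^'r^'p) set) \<Rightarrow> real \<Rightarrow> real \<Rightarrow> bool" where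
  "C1_curve \<gamma> a b \<longleftrightarrow> (\<exists>c. C1_lift c \<gamma> a b)"

text \<open>
  Any two lifts of \<open>\<gamma>\<close> differ by a \<open>C\<^sup>1\<close> curve of orthogonal matrices, and the metric is invariant under
  the orthogonal group, so the length does not depend on the chosen lift.
\<close>

definition curve_length :: "(real \<Rightarrow> (real^'r^'p) set) \<Rightarrow> real \<Rightarrow> real \<Rightarrow> real" where
  "curve_length \<gamma> a b =
     (let c = (SOME c. C1_lift c \<gamma> a b)
      in integral {a..b} (\<lambda>t. sqrt (quot_metric (c t)
           (vector_derivative c (at t)) (vector_derivative c (at t)))))"

text \<open>
  Geodesics are parametrized on \<open>{0..1}\<close> proportionally to arc length and are locally length
  minimizing.  Constant curves are geodesics (speed \<open>v = 0\<close>).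
\<close>

definition constant_speed :: "(real \<Rightarrow> (real^'r^'p) set) \<Rightarrow> bool" where
  "constant_speed \<gamma> \<longleftrightarrow>
     (\<exists>v. \<forall>a b. 0 \<le> a \<longrightarrow> a \<le> b \<longrightarrow> b \<le> 1 \<longrightarrow> curve_length \<gamma> a b = v * (b - a))"

definition length_minimizing :: "(real \<Rightarrow> (real^'r^'p) set) \<Rightarrow> real \<Rightarrow> real \<Rightarrow> bool" where
  "length_minimizing \<gamma> a b \<longleftrightarrow>
     (\<forall>\<eta>. C1_curve \<eta> a b \<longrightarrow> \<eta> a = \<gamma> a \<longrightarrow> \<eta> b = \<gamma> b \<longrightarrow> curve_length \<gamma> a b \<le> curve_length \<eta> a b)"

definition geodesic :: "(real \<Rightarrow> (real^'r^'p) set) \<Rightarrow> bool" where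
  "geodesic \<gamma> \<longleftrightarrow> C1_curve \<gamma> 0 1 \<and> constant_speed \<gamma> \<and>
     (\<forall>t\<in>{0..1}. \<exists>e>0. \<forall>a b. a \<in> {0..1} \<inter> ball t e \<longrightarrow> b \<in> {0..1} \<inter> ball t e \<longrightarrow> a \<le> b \<longrightarrow>
        length_minimizing \<gamma> a b)"

definition geodesic_joining ::
    "(real \<Rightarrow> (real^'r^'p) set) \<Rightarrow> (real^'r^'p) set \<Rightarrow> (real^'r^'p) set \<Rightarrow> bool" where
  "geodesic_joining \<gamma> P1 P2 \<longleftrightarrow> geodesic \<gamma> \<and> \<gamma> 0 = P1 \<and> \<gamma> 1 = P2"

text \<open>
  Shortest among all \<open>C\<^sup>1\<close> curves of the quotient with the same endpoints, not only among geodesics.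
\<close>

definition shortest_geodesic ::
    "(real \<Rightarrow> (real^'r^'p) set) \<Rightarrow> (real^'r^'p) set \<Rightarrow> (real^'r^'p) set \<Rightarrow> bool" where
  "shortest_geodesic \<gamma> P1 P2 \<longleftrightarrow> geodesic_joining \<gamma> P1 P2 \<and> length_minimizing \<gamma> 0 1"

definition geodesically_convex :: "(real^'r^'p) set set \<Rightarrow> bool" where
  "geodesically_convex S \<longleftrightarrow>
     (\<forall>P1\<in>S. \<forall>P2\<in>S. \<exists>\<gamma>. geodesic_joining \<gamma> P1 P2 \<and> \<gamma> ` {0..1} \<subseteq> S)"

end

theory Submission
  imports Defs
begin

text \<open>
  The distance of two classes is attained at aligned representatives \<open>A\<close>, \<open>B\<close>, for which
  \<open>transpose A ** B\<close> is symmetric; the segment from \<open>A\<close> to \<open>B\<close> is then horizontal and its length is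
  the distance.  No curve is shorter, because the distance to the start grows at most at the norm of
  the horizontal part of the velocity of a lift.  Inside the ball the distance of two points is
  smaller than the least singular value of either, so the aligned representative is unique, and strict
  convexity of the norm makes the geodesic unique.  For the convexity of the ball, the squared
  distance \<open>f\<close> to the centre has no interior maximum along the segment: its second derivative is
  bounded below by \<open>2 * norm (B - A)\<^sup>2 * (1 - e\<^sup>2 / (2 * \<sigma> * (\<sigma> - e)))\<close>, where \<open>\<sigma>\<close> is the least singular
  value of the centre and \<open>e < 2 * \<sigma> / 3\<close> the distance to the centre.
\<close>

subsection \<open>Matrix algebra\<close>

text \<open>The obstacle is that the squared distance to the centre is a minimum over the orthogonal
  group, and a minimum of convex functions need not be convex. The bound on its second differences
  is therefore proved as one inequality for every orthogonal \<open>Q\<close>, without any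
  differentiability of the distance. Moving \<open>Q\<close> away from the identity costs at least
  \<open>\<sigma> * (\<sigma> - e) * q\<^sup>2\<close>, where \<open>q = norm (mat 1 - Q)\<close>.
  After a displacement \<open>h\<close> along the segment it gains, to first order in
  \<open>q\<close>, at most \<open>\<bar>h\<bar> * q\<close> times the norm of
  \<open>transpose A ** \<theta> - transpose \<theta> ** A\<close>, with
  \<open>\<theta> = B - A\<close> and \<open>A\<close> here the aligned centre. Minimizing this
  quadratic in \<open>q\<close> produces the term subtracted from 1 in the bound.

  The fraction 1/3 enters through the triangle inequality: points of a segment between two points of
  the ball are less than \<open>2 * x\<close> from the centre, and at
  \<open>e = 2 * \<sigma> / 3\<close> the condition
  \<open>e\<^sup>2 < 2 * \<sigma> * (\<sigma> - e)\<close> reads 4/9 < 2/3.\<close>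

lemma bounded_bilinear_matrix_mult:
  "bounded_bilinear ((**) :: real^'n^'m \<Rightarrow> real^'q^'n \<Rightarrow> real^'q^'m)"
  unfolding bilinear_conv_bounded_bilinear[symmetric] bilinear_def
  by (auto intro!: linearI simp: vec_eq_iff matrix_matrix_mult_def sum.distrib
      sum_distrib_left algebra_simps)

lemmas matrix_mult_distribs =
  bounded_bilinear.add_left[OF bounded_bilinear_matrix_mult]
  bounded_bilinear.add_right[OF bounded_bilinear_matrix_mult]
  bounded_bilinear.diff_left[OF bounded_bilinear_matrix_mult]
  bounded_bilinear.diff_right[OF bounded_bilinear_matrix_mult]
  bounded_bilinear.minus_left[OF bounded_bilinear_matrix_mult]
  bounded_bilinear.minus_right[OF bounded_bilinear_matrix_mult]
  bounded_bilinear.scaleR_left[OF bounded_bilinear_matrix_mult]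
  bounded_bilinear.scaleR_right[OF bounded_bilinear_matrix_mult]
  bounded_bilinear.zero_left[OF bounded_bilinear_matrix_mult]
  bounded_bilinear.zero_right[OF bounded_bilinear_matrix_mult]

lemma transpose_arith:
  fixes A B :: "real^'n^'m"
  shows "transpose (A + B) = transpose A + transpose B"
    and "transpose (A - B) = transpose A - transpose B"
    and "transpose (- A) = - transpose A"
    and "transpose (k *\<^sub>R A) = k *\<^sub>R transpose A"
  by (simp_all add: transpose_def vec_eq_iff)

lemma inner_transpose:
  fixes A B :: "real^'n^'m"
  shows "transpose A \<bullet> transpose B = A \<bullet> B"
  unfolding inner_vec_def transpose_def by (simp, rule sum.swap)

lemma norm_transpose:
  fixes A :: "real^'n^'m"
  shows "norm (transpose A) = norm A"
  by (simp add: norm_eq_sqrt_inner inner_transpose)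

lemma inner_matrix_mult_left:
  fixes A :: "real^'n^'m" and B :: "real^'q^'n"
  shows "(A ** B) \<bullet> C = B \<bullet> (transpose A ** C)"
  by (simp add: inner_matrix_eq_trace matrix_transpose_mul matrix_mul_assoc)

lemma inner_matrix_mult_right:
  fixes A :: "real^'n^'m" and B :: "real^'q^'n"
  shows "(A ** B) \<bullet> C = A \<bullet> (C ** transpose B)"
proof -
  have "(A ** B) \<bullet> C = (transpose B ** transpose A) \<bullet> transpose C"
    by (simp add: matrix_transpose_mul[symmetric] inner_transpose)
  also have "\<dots> = transpose A \<bullet> transpose (C ** transpose B)"
    by (simp add: inner_matrix_mult_left matrix_transpose_mul)
  finally show ?thesis by (simp add: inner_transpose)
qed

lemma inner_matrix_vector:
  fixes A :: "real^'n^'m"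
  shows "(A *v v) \<bullet> w = v \<bullet> (transpose A *v w)"
  by (metis dot_lmul_matrix inner_commute transpose_matrix_vector)

lemma norm_matrix_vector_le:
  fixes A :: "real^'n^'m"
  shows "norm (A *v v) \<le> norm A * norm v"
proof -
  have "norm (A *v v) = L2_set (\<lambda>i. norm ((A *v v) $ i)) UNIV"
    by (simp add: norm_vec_def)
  also have "\<dots> \<le> L2_set (\<lambda>i. norm (A $ i) * norm v) UNIV"
    by (rule L2_set_mono) (simp_all add: matrix_vector_mul_component Cauchy_Schwarz_ineq2)
  also have "\<dots> = norm A * norm v"
    by (simp add: norm_vec_def[of A] L2_set_left_distrib)
  finally show ?thesis .
qed

lemma column_matrix_mult:
  fixes A :: "real^'n^'m"
  shows "column j (A ** B) = A *v column j B"
  by (simp add: column_def matrix_matrix_mult_def matrix_vector_mult_def vec_eq_iff)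

lemma inner_columns:
  fixes A B :: "real^'n^'m"
  shows "A \<bullet> B = (\<Sum>j\<in>UNIV. column j A \<bullet> column j B)"
  unfolding inner_vec_def column_def by (simp, rule sum.swap)

lemma norm_matrix_mult_le:
  fixes A :: "real^'n^'m" and B :: "real^'k^'n"
  shows "norm (A ** B) \<le> norm A * norm B"
proof (rule power2_le_imp_le)
  have "(norm (A ** B))\<^sup>2 = (\<Sum>j\<in>UNIV. (norm (A *v column j B))\<^sup>2)"
    by (simp add: power2_norm_eq_inner inner_columns[of "A ** B"] column_matrix_mult)
  also have "\<dots> \<le> (\<Sum>j\<in>UNIV. (norm A * norm (column j B))\<^sup>2)"
    by (intro sum_mono power_mono norm_matrix_vector_le) auto
  also have "\<dots> = (norm A * norm B)\<^sup>2"
    by (simp add: power_mult_distrib power2_norm_eq_inner inner_columns[of B] sum_distrib_left)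
  finally show "(norm (A ** B))\<^sup>2 \<le> (norm A * norm B)\<^sup>2" .
qed auto

lemma norm_orthogonal_right:
  fixes A :: "real^'n^'m"
  assumes "orthogonal_matrix Q"
  shows "norm (A ** Q) = norm A"
proof -
  have "(A ** Q) \<bullet> (A ** Q) = A \<bullet> (A ** (Q ** transpose Q))"
    by (simp add: inner_matrix_mult_right matrix_mul_assoc)
  then show ?thesis
    using assms by (simp add: orthogonal_matrix_def norm_eq_sqrt_inner)
qed

lemma norm_orthogonal_matrix_vector:
  fixes Q :: "real^'n^'n"
  assumes "orthogonal_matrix Q"
  shows "norm (Q *v v) = norm v"
  by (metis assms matrix_of_matrix_vector_mul matrix_vector_mul_linear orthogonal_transformation
      orthogonal_transformation_matrix)

lemma orthogonal_cancel:
  fixes A :: "real^'n^'m"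
  assumes "orthogonal_matrix Q"
  shows "A ** Q ** transpose Q = A" "A ** transpose Q ** Q = A"
  using assms by (simp_all add: orthogonal_matrix_def flip: matrix_mul_assoc)

text \<open>Both sides are sums over the columns of \<open>X\<close>, so a bound for vectors passes
  to matrices.\<close>

lemma inner_quadratic_lower:
  fixes X :: "real^'k^'n" and S :: "real^'n^'n"
  assumes "\<And>v. s * (norm v)\<^sup>2 \<le> v \<bullet> (S *v v)"
  shows "s * (norm X)\<^sup>2 \<le> X \<bullet> (S ** X)"
proof -
  have "s * (norm X)\<^sup>2 = (\<Sum>j\<in>UNIV. s * (norm (column j X))\<^sup>2)"
    by (simp add: power2_norm_eq_inner inner_columns[of X X] sum_distrib_left)
  also have "\<dots> \<le> (\<Sum>j\<in>UNIV. column j X \<bullet> (S *v column j X))"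
    by (intro sum_mono assms)
  also have "\<dots> = X \<bullet> (S ** X)"
    by (simp add: inner_columns[of X] column_matrix_mult)
  finally show ?thesis .
qed

lemma norm_matrix_mult_lower:
  fixes A :: "real^'n^'m" and X :: "real^'k^'n"
  assumes "0 \<le> m" "\<And>v. m * norm v \<le> norm (A *v v)"
  shows "m * norm X \<le> norm (A ** X)"
proof (rule power2_le_imp_le)
  have "m\<^sup>2 * (norm v)\<^sup>2 \<le> v \<bullet> ((transpose A ** A) *v v)" for v
  proof -
    have "(m * norm v)\<^sup>2 \<le> (norm (A *v v))\<^sup>2"
      using assms by (intro power_mono) auto
    then show ?thesis
      by (simp add: power_mult_distrib power2_norm_eq_inner inner_matrix_vector
          flip: matrix_vector_mul_assoc)
  qed
  from inner_quadratic_lower[OF this, of X]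
  show "(m * norm X)\<^sup>2 \<le> (norm (A ** X))\<^sup>2"
    by (simp add: power_mult_distrib power2_norm_eq_inner inner_matrix_mult_left matrix_mul_assoc)
qed auto

section \<open>Skew matrices and curves of orthogonal matrices\<close>

lemma skew_quadratic_zero:
  fixes K :: "real^'n^'n"
  assumes "transpose K = - K"
  shows "v \<bullet> (K *v v) = 0"
proof -
  have "v \<bullet> (K *v v) = v \<bullet> (transpose K *v v)"
    by (metis inner_matrix_vector inner_commute)
  also have "\<dots> = - (v \<bullet> (K *v v))"
    using assms matrix_vector_mult_diff_rdistrib[of 0 K v] by simp
  finally show ?thesis by simp
qed

lemma has_vector_derivative_quadratic_remainder:
  fixes f :: "real \<Rightarrow> 'a::real_normed_vector"
  assumes "\<And>h. norm (f h - f 0 - h *\<^sub>R D) \<le> M * h\<^sup>2"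
  shows "(f has_vector_derivative D) (at 0)"
proof -
  have "((\<lambda>h. norm (f (0 + h) - f 0 - h *\<^sub>R D) / norm h) \<longlongrightarrow> 0) (at 0)"
  proof (rule Lim_null_comparison)
    show "\<forall>\<^sub>F h in at 0. norm (norm (f (0 + h) - f 0 - h *\<^sub>R D) / norm h) \<le> M * \<bar>h\<bar>"
    proof (rule eventuallyI)
      fix h :: real
      show "norm (norm (f (0 + h) - f 0 - h *\<^sub>R D) / norm h) \<le> M * \<bar>h\<bar>"
        using assms[of h] by (cases "h = 0") (auto simp: divide_simps power2_eq_square abs_if split: if_splits)
    qed
    show "((\<lambda>h::real. M * \<bar>h\<bar>) \<longlongrightarrow> 0) (at 0)"
      by (auto intro!: tendsto_eq_intros)
  qed
  then show ?thesis
    by (simp add: has_vector_derivative_def has_derivative_at bounded_linear_scaleR_left)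
qed

lemma has_vector_derivative_matrix_mult:
  fixes f :: "real \<Rightarrow> real^'n^'m" and g :: "real \<Rightarrow> real^'q^'n"
  assumes "(f has_vector_derivative f') (at x within S)" "(g has_vector_derivative g') (at x within S)"
  shows "((\<lambda>t. f t ** g t) has_vector_derivative f x ** g' + f' ** g x) (at x within S)"
  using bounded_bilinear.FDERIV[OF bounded_bilinear_matrix_mult
      assms[unfolded has_vector_derivative_def]]
  by (simp add: has_vector_derivative_def matrix_mult_distribs scaleR_add_right)

text \<open>The Cayley transform of \<open>(h / 2) *\<^sub>R W\<close>, which avoids the matrix exponential.\<close>

lemma orthogonal_curve_exists:
  fixes W :: "real^'n^'n"
  assumes "transpose W = - W"
  obtains Q :: "real \<Rightarrow> real^'n^'n" where
    "\<And>h. orthogonal_matrix (Q h)" "Q 0 = mat 1" "(Q has_vector_derivative W) (at 0)"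
proof -
  define K where "K h = (h / 2) *\<^sub>R W" for h :: real
  have K: "transpose (K h) = - K h" for h
    using assms by (simp add: K_def transpose_arith)
  have Kv: "v \<bullet> (K h *v v) = 0" for h v
    using skew_quadratic_zero[OF K] .
  \<comment> \<open>Skewness kills the cross term: both \<open>mat 1 - K h\<close> and
    \<open>mat 1 + K h\<close> send \<open>v\<close> to a vector of squared norm
    \<open>(norm v)\<^sup>2 + (norm (K h *v v))\<^sup>2\<close>. Hence the first is invertible and
    the quotient \<open>Q h\<close> is an isometry.\<close>
  have low: "norm v \<le> norm ((mat 1 - K h) *v v)" for h v
  proof (rule power2_le_imp_le)
    show "(norm v)\<^sup>2 \<le> (norm ((mat 1 - K h) *v v))\<^sup>2"
      unfolding power2_norm_eq_inner
      using Kv[of v h] by (simp add: matrix_vector_mult_diff_rdistrib inner_diff_left inner_diff_right inner_commute)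
  qed auto
  have eqn: "norm ((mat 1 + K h) *v v) = norm ((mat 1 - K h) *v v)" for h v
    unfolding norm_eq_sqrt_inner
    using Kv[of v h] by (simp add: matrix_vector_mult_diff_rdistrib matrix_vector_mult_add_rdistrib
        inner_diff_left inner_diff_right inner_add_left inner_add_right inner_commute)
  have "\<exists>R. (mat 1 - K h) ** R = mat 1 \<and> R ** (mat 1 - K h) = mat 1" for h
  proof -
    have "inj ((*v) (mat 1 - K h))"
    proof (rule injI)
      fix x y assume "(mat 1 - K h) *v x = (mat 1 - K h) *v y"
      then have "(mat 1 - K h) *v (x - y) = 0"
        by (simp add: matrix_vector_mult_diff_distrib)
      then show "x = y" using low[of "x - y" h] by simp
    qed
    then show ?thesis
      using matrix_left_invertible_injective matrix_left_right_inverse by metis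
  qed
  then obtain R where R: "(mat 1 - K h) ** R h = mat 1" "R h ** (mat 1 - K h) = mat 1" for h
    by metis
  define Q where "Q h = (mat 1 + K h) ** R h" for h
  have "norm (Q h *v v) = norm v" for h v
  proof -
    have "norm (Q h *v v) = norm ((mat 1 - K h) *v (R h *v v))"
      by (simp add: Q_def eqn flip: matrix_vector_mul_assoc)
    then show ?thesis by (simp add: matrix_vector_mul_assoc R)
  qed
  then have orth: "orthogonal_matrix (Q h)" for h
    by (metis matrix_of_matrix_vector_mul matrix_vector_mul_linear orthogonal_transformation
        orthogonal_transformation_matrix)
  have K0: "K 0 = 0" by (simp add: K_def)
  have Q0: "Q 0 = mat 1" using R(1)[of 0] by (simp add: Q_def K0)
  \<comment> \<open>Using this equation twice leaves a remainder with the factor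
    \<open>h\<^sup>2\<close>; the uniform bound \<open>normR\<close> then replaces any continuity of
    the inverse in \<open>h\<close>.\<close>
  have RI: "R h = mat 1 + K h ** R h" for h
    using R(1)[of h] by (simp add: matrix_mult_distribs algebra_simps)
  have normR: "norm (R h) \<le> norm (mat 1 :: real^'n^'n)" for h
    using norm_matrix_mult_lower[of 1 "mat 1 - K h" "R h"] low R(1)[of h] by simp
  have rem: "Q h - Q 0 - h *\<^sub>R W = (h\<^sup>2 / 2) *\<^sub>R ((W ** W) ** R h)" for h
  proof -
    have 1: "Q h = mat 1 + (K h ** R h + K h ** R h)"
      using arg_cong[OF RI[of h], of "\<lambda>x. x + K h ** R h"]
      by (simp add: Q_def matrix_mult_distribs add.assoc)
    have 2: "K h ** R h = K h + K h ** (K h ** R h)"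
      using arg_cong[OF RI[of h], of "\<lambda>x. K h ** x"] by (simp add: matrix_mult_distribs)
    have 3: "K h ** (K h ** R h) = (h\<^sup>2 / 4) *\<^sub>R ((W ** W) ** R h)"
      by (simp add: K_def matrix_mult_distribs matrix_mul_assoc power2_eq_square)
    have 4: "h *\<^sub>R W = K h + K h"
      by (simp add: K_def flip: scaleR_left_distrib)
    have 5: "(h\<^sup>2 / 2) *\<^sub>R Z = (h\<^sup>2 / 4) *\<^sub>R Z + (h\<^sup>2 / 4) *\<^sub>R Z" for Z :: "real^'n^'n"
      by (simp flip: scaleR_left_distrib)
    have "Q h - Q 0 - h *\<^sub>R W = K h ** (K h ** R h) + K h ** (K h ** R h)"
      unfolding 1 4 Q0 by (subst (1 2) 2) (simp add: algebra_simps)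
    then show ?thesis by (simp only: 3 5)
  qed
  have "(Q has_vector_derivative W) (at 0)"
  proof (rule has_vector_derivative_quadratic_remainder)
    fix h :: real
    have "norm (Q h - Q 0 - h *\<^sub>R W) = h\<^sup>2 / 2 * norm ((W ** W) ** R h)"
      by (simp add: rem)
    moreover have "h\<^sup>2 * norm ((W ** W) ** R h) \<le> h\<^sup>2 * (norm (W ** W) * norm (mat 1 :: real^'n^'n))"
    proof (rule mult_left_mono)
      show "norm ((W ** W) ** R h) \<le> norm (W ** W) * norm (mat 1 :: real^'n^'n)"
        using norm_matrix_mult_le[of "W ** W" "R h"] normR[of h]
        by (meson mult_left_mono norm_ge_zero order_trans)
    qed simp
    ultimately show "norm (Q h - Q 0 - h *\<^sub>R W)
        \<le> (norm (W ** W) * norm (mat 1 :: real^'n^'n) / 2) * h\<^sup>2"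
      by (simp add: mult.commute)
  qed
  with orth Q0 show thesis by (rule that)
qed

subsection \<open>Distance of orbits\<close>

lemma orthogonal_matrix_eq:
  "orthogonal_matrix (Q :: real^'n^'n) \<longleftrightarrow> transpose Q ** Q = mat 1"
  using matrix_left_right_inverse unfolding orthogonal_matrix_def by blast

lemma orbit_class_self: "A \<in> orbit_class A"
  unfolding orbit_class_def using orthogonal_matrix_id by (metis (mono_tags, lifting) matrix_mul_rid mem_Collect_eq)

lemma orbit_class_mult:
  assumes "orthogonal_matrix Q"
  shows "orbit_class (A ** Q) = orbit_class A"
proof -
  have "A ** Q' \<in> orbit_class (A ** Q)" if "orthogonal_matrix Q'" for Q'
  proof -
    have "A ** Q' = A ** Q ** (transpose Q ** Q')"
      using assms by (simp add: matrix_mul_assoc orthogonal_cancel)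
    moreover have "orthogonal_matrix (transpose Q ** Q')"
      using assms that by (simp add: orthogonal_matrix_mul)
    ultimately show ?thesis unfolding orbit_class_def by blast
  qed
  moreover have "A ** Q ** Q' \<in> orbit_class A" if "orthogonal_matrix Q'" for Q'
    using orthogonal_matrix_mul[OF assms that] unfolding orbit_class_def
    by (auto simp flip: matrix_mul_assoc)
  ultimately show ?thesis unfolding orbit_class_def by blast
qed

lemma orbit_class_eqD:
  assumes "orbit_class A = orbit_class B"
  obtains Q where "orthogonal_matrix Q" "B = A ** Q"
proof -
  have "B \<in> orbit_class A"
    using orbit_class_self assms by blast
  with that show thesis
    unfolding orbit_class_def by blast
qed

text \<open>The distance on representatives, free of the choice in \<open>geo_dist\<close>. That a
  pair is aligned can then be written \<open>align_dist A B = norm (B - A)\<close>.\<close>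

definition align_dist :: "real^'r^'p \<Rightarrow> real^'r^'p \<Rightarrow> real" where
  "align_dist A B = (INF Q \<in> {Q. orthogonal_matrix Q}. norm (B ** Q - A))"

text \<open>Other representatives only reindex the infimum by
  \<open>\<lambda>Q. Q2 ** Q ** transpose Q1\<close>, a bijection of the orthogonal group.\<close>

lemma geo_dist_orbit_class: "geo_dist (orbit_class A) (orbit_class B) = align_dist A B"
proof -
  define Y1 where "Y1 = (SOME Y. Y \<in> orbit_class A)"
  define Y2 where "Y2 = (SOME Y. Y \<in> orbit_class B)"
  have "Y1 \<in> orbit_class A" "Y2 \<in> orbit_class B"
    unfolding Y1_def Y2_def by (rule someI, rule orbit_class_self)+
  then obtain Q1 Q2 where Q: "orthogonal_matrix Q1" "Y1 = A ** Q1" "orthogonal_matrix Q2" "Y2 = B ** Q2"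
    unfolding orbit_class_def by blast
  have eq: "norm (Y2 ** Q - Y1) = norm (B ** (Q2 ** Q ** transpose Q1) - A)" for Q
  proof -
    have "norm (B ** (Q2 ** Q ** transpose Q1) - A) =
        norm ((B ** (Q2 ** Q ** transpose Q1) - A) ** Q1)"
      using Q by (simp add: norm_orthogonal_right)
    also have "(B ** (Q2 ** Q ** transpose Q1) - A) ** Q1 = Y2 ** Q - Y1"
      using Q by (simp add: matrix_mult_distribs matrix_mul_assoc orthogonal_cancel)
    finally show ?thesis by simp
  qed
  have "(\<lambda>Q. Q2 ** Q ** transpose Q1) ` {Q. orthogonal_matrix Q} = {Q. orthogonal_matrix Q}"
  proof safe
    fix Q :: "real^'a^'a" assume "orthogonal_matrix Q"
    then show "orthogonal_matrix (Q2 ** Q ** transpose Q1)"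
      using Q by (simp add: orthogonal_matrix_mul)
  next
    fix Q :: "real^'a^'a" assume "orthogonal_matrix Q"
    then have "orthogonal_matrix (transpose Q2 ** Q ** Q1)"
      using Q by (simp add: orthogonal_matrix_mul)
    moreover have "Q = Q2 ** (transpose Q2 ** Q ** Q1) ** transpose Q1"
      using Q by (simp add: matrix_mul_assoc orthogonal_cancel) (simp add: orthogonal_matrix_def)
    ultimately show "Q \<in> (\<lambda>Q. Q2 ** Q ** transpose Q1) ` {Q. orthogonal_matrix Q}"
      by blast
  qed
  then have "(\<lambda>Q. norm (Y2 ** Q - Y1)) ` {Q. orthogonal_matrix Q} =
      (\<lambda>Q. norm (B ** Q - A)) ` {Q. orthogonal_matrix Q}"
    unfolding eq by (metis (no_types, lifting) image_cong image_image)
  then show ?thesis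
    unfolding geo_dist_def align_dist_def Let_def Y1_def Y2_def by simp
qed

lemma compact_orthogonal_matrices: "compact {Q :: real^'n^'n. orthogonal_matrix Q}"
proof -
  have "norm Q = norm (mat 1 :: real^'n^'n)" if "orthogonal_matrix Q" for Q :: "real^'n^'n"
    using norm_orthogonal_right[OF that, of "mat 1 :: real^'n^'n"] by simp
  then have "bounded {Q :: real^'n^'n. orthogonal_matrix Q}"
    by (auto intro!: boundedI)
  moreover have "closed {Q :: real^'n^'n. orthogonal_matrix Q}"
  proof -
    have "linear (transpose :: real^'n^'n \<Rightarrow> real^'n^'n)"
      by (auto intro!: linearI simp: transpose_arith)
    then have "continuous_on UNIV (transpose :: real^'n^'n \<Rightarrow> real^'n^'n)"
      by (simp add: linear_continuous_on linear_conv_bounded_linear)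
    then have "continuous_on UNIV (\<lambda>Q :: real^'n^'n. transpose Q ** Q)"
      by (intro bounded_bilinear.continuous_on[OF bounded_bilinear_matrix_mult] continuous_on_id)
    then have "closed ((\<lambda>Q :: real^'n^'n. transpose Q ** Q) -` {mat 1})"
      by (intro closed_vimage) auto
    then show ?thesis
      by (simp add: vimage_def orthogonal_matrix_eq)
  qed
  ultimately show ?thesis
    by (simp add: compact_eq_bounded_closed)
qed

lemma align_dist_le:
  assumes "orthogonal_matrix Q"
  shows "align_dist A B \<le> norm (B ** Q - A)"
  unfolding align_dist_def
  by (rule cINF_lower) (use assms in \<open>auto intro!: bdd_belowI[where m = 0]\<close>)

lemma align_dist_le_norm: "align_dist A B \<le> norm (B - A)"
  using align_dist_le[OF orthogonal_matrix_id, of A B] by simp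

lemma align_dist_attained:
  obtains Q where "orthogonal_matrix Q" "align_dist A B = norm (B ** Q - A)"
proof -
  have "continuous_on {Q. orthogonal_matrix Q} (\<lambda>Q. norm (B ** Q - A))"
    by (intro continuous_intros bounded_bilinear.continuous_on[OF bounded_bilinear_matrix_mult])
  then obtain Q where Q: "orthogonal_matrix Q"
      "\<And>Q'. orthogonal_matrix Q' \<Longrightarrow> norm (B ** Q - A) \<le> norm (B ** Q' - A)"
    using continuous_attains_inf[OF compact_orthogonal_matrices] orthogonal_matrix_id by blast
  have "norm (B ** Q - A) \<le> align_dist A B"
    unfolding align_dist_def
    by (rule cINF_greatest) (use Q orthogonal_matrix_id in auto)
  with Q(1) align_dist_le[OF Q(1), of A B] that show thesis
    by fastforce
qed

lemma align_dist_nonneg: "0 \<le> align_dist A B"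
  by (metis align_dist_attained norm_ge_zero)

lemma align_dist_orbit_cong:
  assumes "orbit_class A = orbit_class A'" "orbit_class B = orbit_class B'"
  shows "align_dist A B = align_dist A' B'"
  by (metis assms geo_dist_orbit_class)

lemma align_dist_mult_right:
  assumes "orthogonal_matrix Q"
  shows "align_dist A (B ** Q) = align_dist A B" "align_dist (A ** Q) B = align_dist A B"
  by (intro align_dist_orbit_cong; simp add: orbit_class_mult assms)+

lemma align_dist_commute:
  fixes A B :: "real^'r^'p"
  shows "align_dist A B = align_dist B A"
proof -
  have "align_dist A B \<le> align_dist B A" for A B :: "real^'r^'p"
  proof -
    obtain Q where Q: "orthogonal_matrix Q" "align_dist B A = norm (A ** Q - B)"
      by (rule align_dist_attained)
    have "align_dist A B = align_dist (A ** Q) B"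
      by (simp add: align_dist_mult_right Q)
    also have "\<dots> \<le> norm (B - A ** Q)" by (rule align_dist_le_norm)
    finally show ?thesis by (simp add: Q norm_minus_commute)
  qed
  then show ?thesis by (blast intro: order.antisym)
qed

lemma align_dist_triangle: "align_dist A C \<le> align_dist A B + align_dist B C"
proof -
  obtain Q where Q: "orthogonal_matrix Q" "align_dist A B = norm (B ** Q - A)"
    by (rule align_dist_attained)
  obtain R where R: "orthogonal_matrix R" "align_dist (B ** Q) C = norm (C ** R - B ** Q)"
    by (rule align_dist_attained)
  have "align_dist A C \<le> norm (C ** R - A)" by (rule align_dist_le[OF R(1)])
  also have "\<dots> \<le> norm (B ** Q - A) + norm (C ** R - B ** Q)"
    using norm_triangle_ineq[of "B ** Q - A" "C ** R - B ** Q"] by simp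
  finally show ?thesis
    using Q R by (simp add: align_dist_mult_right)
qed

text \<open>First-order optimality of the identity for the minimization over the orthogonal group.\<close>

lemma aligned_symmetric:
  fixes A B :: "real^'r^'p"
  assumes "align_dist A B = norm (B - A)"
  shows "transpose A ** B = transpose B ** A"
proof -
  have "(B ** W) \<bullet> (B - A) = 0" if W: "transpose W = - W" for W :: "real^'r^'r"
  proof -
    obtain Q where Q: "\<And>h. orthogonal_matrix (Q h)" "Q 0 = mat 1"
        "(Q has_vector_derivative W) (at 0)"
      using orthogonal_curve_exists[OF W] by blast
    define F where "F h = B ** Q h - A" for h
    have "((\<lambda>h. B ** Q h) has_vector_derivative B ** W) (at 0)"
      by (rule bounded_linear.has_vector_derivative[OF
            bounded_bilinear.bounded_linear_right[OF bounded_bilinear_matrix_mult] Q(3)])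
    then have "(F has_vector_derivative B ** W) (at 0)"
      unfolding F_def by (auto intro!: derivative_eq_intros)
    then have "(F has_derivative (\<lambda>h. h *\<^sub>R (B ** W))) (at 0)"
      by (simp add: has_vector_derivative_def)
    then have "((\<lambda>h. F h \<bullet> F h) has_derivative (\<lambda>h. F 0 \<bullet> h *\<^sub>R (B ** W) + h *\<^sub>R (B ** W) \<bullet> F 0)) (at 0)"
      by (intro has_derivative_inner)
    then have D: "((\<lambda>h. F h \<bullet> F h) has_real_derivative 2 * ((B ** W) \<bullet> F 0)) (at 0)"
      unfolding has_field_derivative_def
      by (rule has_derivative_eq_rhs) (auto simp: inner_commute algebra_simps)
    have F0: "F 0 = B - A" by (simp add: F_def Q)
    have "F 0 \<bullet> F 0 \<le> F h \<bullet> F h" for h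
    proof -
      have "norm (F 0) \<le> norm (F h)"
        using align_dist_le[OF Q(1), of A B h] assms by (simp add: F_def Q)
      then show ?thesis by (simp add: norm_le)
    qed
    then have "2 * ((B ** W) \<bullet> F 0) = 0"
      by (intro DERIV_local_min[OF D, of 1]) auto
    then show ?thesis by (simp add: F0)
  qed
  \<comment> \<open>The derivative vanishes in every vertical direction \<open>B ** W\<close>, so
    \<open>B - A\<close> is horizontal at \<open>B\<close>; the symmetric summand
    \<open>transpose B ** B\<close> then drops out.\<close>
  then have "B - A \<in> horizontal_space B"
    by (auto simp: horizontal_space_def vertical_space_def orthogonal_comp_def orthogonal_def)
  then have "transpose (transpose B ** (B - A)) = transpose B ** (B - A)"
    by (simp add: horizontal_space_eq)
  then show ?thesis
    by (simp add: matrix_mult_distribs transpose_arith matrix_transpose_mul)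
qed

section \<open>Full column rank as injectivity\<close>

lemma full_col_rank_iff_inj:
  fixes A :: "real^'r^'p"
  shows "A \<in> full_col_rank \<longleftrightarrow> (\<forall>v. A *v v = 0 \<longrightarrow> v = 0)"
proof -
  have "A \<in> full_col_rank \<longleftrightarrow> inj ((*v) A)"
    by (simp add: full_col_rank_def full_rank_injective)
  also have "\<dots> \<longleftrightarrow> (\<forall>v. A *v v = 0 \<longrightarrow> v = 0)"
    by (rule linear_injective_0) (rule matrix_vector_mul_linear)
  finally show ?thesis .
qed

lemma full_col_rank_left_inverse:
  fixes A :: "real^'r^'p"
  assumes "A \<in> full_col_rank"
  obtains L where "L ** A = mat 1"
  using assms unfolding full_col_rank_def full_rank_injective mem_Collect_eq
    matrix_left_invertible_injective[symmetric] by blast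

subsection \<open>Horizontal lifts\<close>

lemma subspace_vertical_space: "subspace (vertical_space Y)"
proof (rule subspaceI)
  have "Y ** 0 \<in> vertical_space Y"
    unfolding vertical_space_def by (rule CollectI, rule exI[of _ 0]) (simp add: transpose_def vec_eq_iff)
  then show "0 \<in> vertical_space Y"
    by (simp add: matrix_mult_distribs)
next
  fix x y assume "x \<in> vertical_space Y" "y \<in> vertical_space Y"
  then obtain V W where *: "x = Y ** V" "transpose V = - V" "y = Y ** W" "transpose W = - W"
    unfolding vertical_space_def by blast
  show "x + y \<in> vertical_space Y"
    unfolding vertical_space_def using *
    by (intro CollectI exI[of _ "V + W"]) (simp add: matrix_mult_distribs transpose_arith)
next
  fix k :: real and x assume "x \<in> vertical_space Y"
  then obtain V where *: "x = Y ** V" "transpose V = - V"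
    unfolding vertical_space_def by blast
  show "k *\<^sub>R x \<in> vertical_space Y"
    unfolding vertical_space_def using *
    by (intro CollectI exI[of _ "k *\<^sub>R V"]) (simp add: matrix_mult_distribs transpose_arith)
qed

lemma horizontal_lift_unique:
  assumes "\<xi> \<in> horizontal_space Y" "\<theta> - \<xi> \<in> vertical_space Y"
  shows "horizontal_lift Y \<theta> = \<xi>"
  unfolding horizontal_lift_def
proof (rule the_equality)
  fix \<xi>' assume *: "\<xi>' \<in> horizontal_space Y \<and> \<theta> - \<xi>' \<in> vertical_space Y"
  have "\<xi>' - \<xi> \<in> horizontal_space Y"
    using * assms subspace_orthogonal_comp[of "vertical_space Y"]
    by (auto simp: horizontal_space_def intro: subspace_diff)
  moreover have "(\<theta> - \<xi>) - (\<theta> - \<xi>') \<in> vertical_space Y"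
    using * assms by (blast intro: subspace_diff subspace_vertical_space)
  ultimately show "\<xi>' = \<xi>"
    by (simp add: horizontal_space_def orthogonal_comp_def orthogonal_def) fastforce
qed (use assms in simp)

lemma horizontal_lift_decomp:
  "horizontal_lift Y \<theta> \<in> horizontal_space Y" "\<theta> - horizontal_lift Y \<theta> \<in> vertical_space Y"
proof -
  obtain y z where yz: "y \<in> span (vertical_space Y)"
      "\<And>w. w \<in> span (vertical_space Y) \<Longrightarrow> orthogonal z w" "\<theta> = y + z"
    using orthogonal_subspace_decomp_exists[of "vertical_space Y" \<theta>] by blast
  have sp: "span (vertical_space Y) = vertical_space Y"
    by (simp add: span_eq_iff subspace_vertical_space)
  have z: "z \<in> horizontal_space Y" "\<theta> - z \<in> vertical_space Y"
    using yz unfolding sp by (auto simp: horizontal_space_def orthogonal_comp_def orthogonal_commute)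
  then show "horizontal_lift Y \<theta> \<in> horizontal_space Y" "\<theta> - horizontal_lift Y \<theta> \<in> vertical_space Y"
    using horizontal_lift_unique[OF z] by simp_all
qed

lemma horizontal_lift_cong:
  assumes "\<theta> - \<theta>' \<in> vertical_space Y"
  shows "horizontal_lift Y \<theta> = horizontal_lift Y \<theta>'"
proof (rule horizontal_lift_unique)
  have "(\<theta> - \<theta>') + (\<theta>' - horizontal_lift Y \<theta>') \<in> vertical_space Y"
    by (intro subspace_add subspace_vertical_space assms horizontal_lift_decomp)
  then show "\<theta> - horizontal_lift Y \<theta>' \<in> vertical_space Y" by simp
qed (rule horizontal_lift_decomp)

lemma horizontal_lift_horizontal:
  assumes "\<theta> \<in> horizontal_space Y"
  shows "horizontal_lift Y \<theta> = \<theta>"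
  by (rule horizontal_lift_unique[OF assms]) (simp add: subspace_0 subspace_vertical_space)

lemma horizontal_lift_obtain:
  obtains W where "transpose W = - W" "\<theta> = horizontal_lift Y \<theta> + Y ** W"
proof -
  obtain W where "transpose W = - W" "\<theta> - horizontal_lift Y \<theta> = Y ** W"
    using horizontal_lift_decomp(2)[of \<theta> Y] unfolding vertical_space_def by blast
  then show thesis by (intro that[of W]) (simp_all add: algebra_simps)
qed

lemma horizontal_lift_pythagoras:
  "(norm \<theta>)\<^sup>2 = (norm (horizontal_lift Y \<theta>))\<^sup>2 + (norm (\<theta> - horizontal_lift Y \<theta>))\<^sup>2"
proof -
  have "orthogonal (\<theta> - horizontal_lift Y \<theta>) (horizontal_lift Y \<theta>)"
    using horizontal_lift_decomp(1)[of Y \<theta>] horizontal_lift_decomp(2)[of \<theta> Y]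
    by (simp add: horizontal_space_def orthogonal_comp_def)
  from norm_add_Pythagorean[OF this] show ?thesis by simp
qed

text \<open>By Pythagoras the horizontal lift is the shortest among the matrices that represent a
  given tangent vector, so any representative yields an upper bound for the speed.\<close>

lemma norm_horizontal_lift_le:
  assumes "\<theta> - \<theta>' \<in> vertical_space Y"
  shows "norm (horizontal_lift Y \<theta>) \<le> norm \<theta>'"
  unfolding horizontal_lift_cong[OF assms]
  by (rule power2_le_imp_le) (simp_all add: horizontal_lift_pythagoras[of \<theta>' Y])

lemma sqrt_quot_metric: "sqrt (quot_metric Y \<theta> \<theta>) = norm (horizontal_lift Y \<theta>)"
  by (simp add: quot_metric_def norm_eq_sqrt_inner)

text \<open>Right multiplication by \<open>Q\<close> carries the splitting at \<open>Y\<close> to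
  the splitting at \<open>Y ** Q\<close>; skew matrices are conjugated by \<open>Q\<close> and stay
  skew.\<close>

lemma horizontal_lift_mult_orthogonal:
  fixes Y :: "real^'r^'p"
  assumes Q: "orthogonal_matrix Q"
  shows "horizontal_lift (Y ** Q) (\<theta> ** Q) = horizontal_lift Y \<theta> ** Q"
proof (rule horizontal_lift_unique)
  have "transpose (transpose Y ** horizontal_lift Y \<theta>) = transpose Y ** horizontal_lift Y \<theta>"
    using horizontal_lift_decomp(1)[of Y \<theta>] by (simp add: horizontal_space_eq)
  then have *: "transpose (horizontal_lift Y \<theta>) ** Y = transpose Y ** horizontal_lift Y \<theta>"
    by (simp add: matrix_transpose_mul)
  have "transpose Q ** (transpose (horizontal_lift Y \<theta>) ** Y) ** Q =
      transpose Q ** (transpose Y ** horizontal_lift Y \<theta>) ** Q"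
    by (simp add: *)
  then show "horizontal_lift Y \<theta> ** Q \<in> horizontal_space (Y ** Q)"
    by (simp add: horizontal_space_eq matrix_transpose_mul matrix_mul_assoc)
  obtain W where W: "transpose W = - W" "\<theta> - horizontal_lift Y \<theta> = Y ** W"
    using horizontal_lift_decomp(2)[of \<theta> Y] unfolding vertical_space_def by blast
  have "\<theta> ** Q - horizontal_lift Y \<theta> ** Q = (Y ** Q) ** (transpose Q ** W ** Q)"
    using W Q by (simp add: matrix_mul_assoc orthogonal_cancel flip: bounded_bilinear.diff_left[OF bounded_bilinear_matrix_mult])
  moreover have "transpose (transpose Q ** W ** Q) = - (transpose Q ** W ** Q)"
    using W by (simp add: matrix_transpose_mul matrix_mult_distribs matrix_mul_assoc)
  ultimately show "\<theta> ** Q - horizontal_lift Y \<theta> ** Q \<in> vertical_space (Y ** Q)"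
    unfolding vertical_space_def by blast
qed

text \<open>The vertical vectors are the kernel of the differential of \<open>Y \<mapsto> Y ** transpose Y\<close>.\<close>

lemma vertical_spaceI:
  fixes Y :: "real^'r^'p"
  assumes "Y \<in> full_col_rank" and "\<theta> ** transpose Y + Y ** transpose \<theta> = 0"
  shows "\<theta> \<in> vertical_space Y"
proof -
  obtain L where L: "L ** Y = mat 1"
    using full_col_rank_left_inverse[OF assms(1)] .
  then have L': "transpose Y ** transpose L = mat 1"
    by (simp flip: matrix_transpose_mul)
  \<comment> \<open>The hypothesis multiplied on the right by \<open>transpose L\<close> gives
    \<open>\<theta> = Y ** W\<close>; multiplied by \<open>L\<close> on the left as well, it gives
    skewness of \<open>W\<close>.\<close>
  define W where "W = - (transpose \<theta> ** transpose L)"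
  have "\<theta> ** transpose Y = - (Y ** transpose \<theta>)"
    using assms(2) by (simp add: eq_neg_iff_add_eq_0)
  then have "\<theta> ** transpose Y ** transpose L = Y ** W"
    by (simp add: W_def matrix_mult_distribs matrix_mul_assoc)
  then have \<theta>: "\<theta> = Y ** W"
    by (simp add: L' flip: matrix_mul_assoc)
  have "Y ** W ** transpose Y + Y ** transpose W ** transpose Y = 0"
    using assms(2) by (simp add: \<theta> matrix_transpose_mul matrix_mul_assoc)
  then have "L ** (Y ** W ** transpose Y + Y ** transpose W ** transpose Y) ** transpose L = 0"
    by (simp add: matrix_mult_distribs)
  then have "(L ** Y) ** W ** (transpose Y ** transpose L)
      + (L ** Y) ** transpose W ** (transpose Y ** transpose L) = 0"
    by (simp add: matrix_mult_distribs matrix_mul_assoc)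
  then have "transpose W = - W"
    by (simp add: L L' eq_neg_iff_add_eq_0 add.commute)
  then show ?thesis
    unfolding vertical_space_def using \<theta> by blast
qed

text \<open>The orthogonal matrices that relate the lifts at different parameters are not known to
  be differentiable. The product \<open>c s ** transpose (c s)\<close> is constant on orbits, and
  comparing its two derivatives shows that \<open>\<theta>1 ** Q - \<theta>2\<close> is vertical,
  with \<open>Q\<close> taken at the single parameter \<open>t\<close>.\<close>

lemma norm_horizontal_lift_lift_indep:
  fixes c1 c2 :: "real \<Rightarrow> real^'r^'p"
  assumes "(c1 has_vector_derivative \<theta>1) (at t)" "(c2 has_vector_derivative \<theta>2) (at t)"
    and "open S" "t \<in> S" "\<And>s. s \<in> S \<Longrightarrow> orbit_class (c1 s) = orbit_class (c2 s)"
    and "c2 t \<in> full_col_rank"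
  shows "norm (horizontal_lift (c1 t) \<theta>1) = norm (horizontal_lift (c2 t) \<theta>2)"
proof -
  have bl: "bounded_linear (transpose :: real^'r^'p \<Rightarrow> real^'p^'r)"
    by (auto intro!: linearI simp: transpose_arith simp flip: linear_conv_bounded_linear)
  have D: "((\<lambda>s. c s ** transpose (c s)) has_vector_derivative c t ** transpose \<theta> + \<theta> ** transpose (c t)) (at t)"
    if "(c has_vector_derivative \<theta>) (at t)" for c :: "real \<Rightarrow> real^'r^'p" and \<theta>
    by (intro has_vector_derivative_matrix_mult bounded_linear.has_vector_derivative[OF bl] that)
  have eq: "c1 s ** transpose (c1 s) = c2 s ** transpose (c2 s)" if s: "s \<in> S" for s
  proof -
    obtain Q where Q: "orthogonal_matrix Q" "c2 s = c1 s ** Q"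
      using orbit_class_eqD[OF assms(5)[OF s]] .
    then show ?thesis
      by (simp add: matrix_transpose_mul matrix_mul_assoc orthogonal_cancel)
  qed
  have "c1 t ** transpose \<theta>1 + \<theta>1 ** transpose (c1 t) = c2 t ** transpose \<theta>2 + \<theta>2 ** transpose (c2 t)"
    using has_vector_derivative_transform_within_open[OF D[OF assms(1)] assms(3,4) eq]
      D[OF assms(2)] vector_derivative_unique_at by blast
  moreover obtain Q where Q: "orthogonal_matrix Q" "c2 t = c1 t ** Q"
    using orbit_class_eqD[OF assms(5)[OF assms(4)]] .
  ultimately have "(\<theta>1 ** Q - \<theta>2) ** transpose (c2 t) + c2 t ** transpose (\<theta>1 ** Q - \<theta>2) = 0"
    by (simp add: matrix_transpose_mul matrix_mult_distribs transpose_arith matrix_mul_assoc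
        orthogonal_cancel algebra_simps)
  then have "\<theta>1 ** Q - \<theta>2 \<in> vertical_space (c2 t)"
    by (rule vertical_spaceI[OF assms(6)])
  then have "horizontal_lift (c2 t) \<theta>2 = horizontal_lift (c1 t) \<theta>1 ** Q"
    by (metis horizontal_lift_cong horizontal_lift_mult_orthogonal Q)
  then show ?thesis
    by (simp add: norm_orthogonal_right Q)
qed

subsection \<open>Length of curves and distance\<close>

text \<open>A criterion with upper right Dini derivatives, for functions that need not be
  differentiable: the last point where \<open>\<phi> t - k * (t - a) \<le> \<phi> a\<close> cannot
  lie before \<open>b\<close>.\<close>

lemma right_decrease_imp_le:
  fixes \<phi> :: "real \<Rightarrow> real"
  assumes "a \<le> b" "continuous_on {a..b} \<phi>"
    and loc: "\<And>t e. a \<le> t \<Longrightarrow> t < b \<Longrightarrow> 0 < e \<Longrightarrow>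
      \<exists>d>0. \<forall>s. t < s \<longrightarrow> s < t + d \<longrightarrow> s \<le> b \<longrightarrow> \<phi> s \<le> \<phi> t + e * (s - t)"
  shows "\<phi> b \<le> \<phi> a"
proof (rule field_le_epsilon)
  fix e :: real assume "0 < e"
  \<comment> \<open>The summand 1 keeps the denominator positive when \<open>a = b\<close>.\<close>
  define k where "k = e / (b - a + 1)"
  have k: "0 < k" using \<open>0 < e\<close> assms(1) by (simp add: k_def)
  define T where "T = {a..b} \<inter> (\<lambda>t. \<phi> t - k * (t - a)) -` {..\<phi> a}"
  have "closed T"
    unfolding T_def by (intro continuous_closed_preimage continuous_intros assms(2))
  moreover have "bounded T"
    by (rule bounded_subset[of "{a..b}"]) (auto simp: T_def)
  ultimately have "compact T" by (simp add: compact_eq_bounded_closed)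
  moreover have "T \<noteq> {}" using assms(1) by (auto simp: T_def)
  ultimately obtain m where m: "m \<in> T" "\<And>t. t \<in> T \<Longrightarrow> t \<le> m"
    using compact_attains_sup[of T] by metis
  have "m = b"
  proof (rule ccontr)
    assume "m \<noteq> b"
    with m(1) have mb: "a \<le> m" "m < b" by (auto simp: T_def)
    then obtain d where d: "d > 0"
        "\<forall>s. m < s \<longrightarrow> s < m + d \<longrightarrow> s \<le> b \<longrightarrow> \<phi> s \<le> \<phi> m + k * (s - m)"
      using loc[OF mb k] by blast
    define s where "s = min b (m + d / 2)"
    have s: "m < s" "s < m + d" "s \<le> b" using d mb by (auto simp: s_def)
    then have "\<phi> s \<le> \<phi> m + k * (s - m)" using d by blast
    then have "s \<in> T"
      using m(1) s mb by (auto simp: T_def algebra_simps)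
    with m(2)[of s] s show False by simp
  qed
  with m(1) have "\<phi> b \<le> \<phi> a + k * (b - a)" by (auto simp: T_def)
  also have "k * (b - a) \<le> e"
    using \<open>0 < e\<close> assms(1) by (simp add: k_def divide_simps mult_left_mono)
  finally show "\<phi> b \<le> \<phi> a + e" by simp
qed

text \<open>A positive continuous function on the compact product of interval and unit sphere has a
  positive minimum. This later bounds the skew factors of vertical parts uniformly along a
  curve.\<close>

lemma full_col_rank_uniform_lower:
  fixes c :: "real \<Rightarrow> real^'r^'p"
  assumes "continuous_on {a..b} c" "\<And>t. t \<in> {a..b} \<Longrightarrow> c t \<in> full_col_rank"
  obtains m where "0 < m" "\<And>t v. t \<in> {a..b} \<Longrightarrow> m * norm v \<le> norm (c t *v v)"
proof (cases "a \<le> b")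
  case True
  have bb: "bounded_bilinear ((*v) :: real^'r^'p \<Rightarrow> real^'r \<Rightarrow> real^'p)"
    unfolding bilinear_conv_bounded_bilinear[symmetric] bilinear_def
    by (auto intro!: linearI simp: algebra_simps scaleR_matrix_vector_assoc)
  have "continuous_on ({a..b} \<times> sphere 0 1) (\<lambda>z. norm (c (fst z) *v snd z))"
    by (intro continuous_on_norm bounded_bilinear.continuous_on[OF bb]
        continuous_on_compose2[OF assms(1)] continuous_intros) auto
  moreover have "compact ({a..b} \<times> sphere (0::real^'r) 1)"
    by (intro compact_Times) auto
  moreover have "{a..b} \<times> sphere (0::real^'r) 1 \<noteq> {}"
    using True by (auto simp: sphere_eq_empty)
  ultimately obtain z where z: "z \<in> {a..b} \<times> sphere (0::real^'r) 1"
      "\<And>w. w \<in> {a..b} \<times> sphere 0 1 \<Longrightarrow> norm (c (fst z) *v snd z) \<le> norm (c (fst w) *v snd w)"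
    using continuous_attains_inf by (metis (no_types, lifting))
  define m where "m = norm (c (fst z) *v snd z)"
  have "snd z \<noteq> 0" using z(1) by auto
  then have "0 < m"
    using assms(2)[of "fst z"] z(1) by (auto simp: m_def full_col_rank_iff_inj)
  moreover have "m * norm v \<le> norm (c t *v v)" if t: "t \<in> {a..b}" for t v
  proof (cases "v = 0")
    case False
    have "m \<le> norm (c t *v (inverse (norm v) *\<^sub>R v))"
      using z(2)[of "(t, inverse (norm v) *\<^sub>R v)"] False t by (simp add: m_def)
    also have "\<dots> = norm (c t *v v) / norm v"
      by (simp add: matrix_vector_mult_scaleR divide_inverse mult.commute)
    finally show ?thesis using False by (simp add: field_simps)
  qed simp
  ultimately show thesis by (rule that)
next
  case False
  then show thesis by (intro that[of 1]) auto
qed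

text \<open>The estimate \<open>le\<close> compares two parameters directly, so that continuity of
  the projection onto a varying horizontal space is never discussed.\<close>

lemma continuous_on_norm_horizontal_lift:
  fixes c D :: "real \<Rightarrow> real^'r^'p"
  assumes c: "continuous_on {a..b} c" and D: "continuous_on {a..b} D"
    and rk: "\<And>t. t \<in> {a..b} \<Longrightarrow> c t \<in> full_col_rank"
  shows "continuous_on {a..b} (\<lambda>t. norm (horizontal_lift (c t) (D t)))"
proof -
  obtain m where m: "0 < m" "\<And>t v. t \<in> {a..b} \<Longrightarrow> m * norm v \<le> norm (c t *v v)"
    using full_col_rank_uniform_lower[OF c rk] by blast
  have "bounded (D ` {a..b})"
    by (intro compact_imp_bounded compact_continuous_image D) auto
  then obtain N where N: "\<And>t. t \<in> {a..b} \<Longrightarrow> norm (D t) \<le> N"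
    unfolding bounded_iff by blast
  define g where "g t = norm (horizontal_lift (c t) (D t))" for t
  have le: "g s \<le> g t + norm (D s - D t) + norm (c s - c t) * (N / m)"
    if st: "s \<in> {a..b}" "t \<in> {a..b}" for s t
  proof -
    obtain W where W: "transpose W = - W" "D t = horizontal_lift (c t) (D t) + c t ** W"
      using horizontal_lift_obtain .
    have "m * norm W \<le> norm (c t ** W)"
      using m st by (intro norm_matrix_mult_lower) auto
    also have "\<dots> = norm (D t - horizontal_lift (c t) (D t))"
      using W(2) by (metis add_diff_cancel_left')
    also have "\<dots> \<le> norm (D t)"
      by (rule power2_le_imp_le) (simp_all add: horizontal_lift_pythagoras[of "D t" "c t"])
    also have "\<dots> \<le> N" by (rule N[OF st(2)])
    finally have nW: "norm W \<le> N / m" using m(1) by (simp add: field_simps)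
    \<comment> \<open>The skew factor \<open>W\<close> found at \<open>t\<close> is reused at
      \<open>s\<close>: \<open>D s - c s ** W\<close> represents the same tangent vector as
      \<open>D s\<close> and is close to the horizontal lift at \<open>t\<close>.\<close>
    have "D s - (D s - c s ** W) \<in> vertical_space (c s)"
      using W(1) unfolding vertical_space_def by auto
    then have "g s \<le> norm (D s - c s ** W)"
      unfolding g_def by (rule norm_horizontal_lift_le)
    also have "D s - c s ** W = horizontal_lift (c t) (D t) + (D s - D t) - (c s - c t) ** W"
      by (subst (2) W(2)) (simp add: matrix_mult_distribs)
    also have "norm \<dots> \<le> g t + norm (D s - D t) + norm ((c s - c t) ** W)"
      unfolding g_def by (rule order_trans[OF norm_triangle_ineq4]) (intro add_right_mono norm_triangle_ineq)
    also have "norm ((c s - c t) ** W) \<le> norm (c s - c t) * (N / m)"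
      using norm_matrix_mult_le[of "c s - c t" W] nW by (meson mult_left_mono norm_ge_zero order_trans)
    finally show ?thesis by simp
  qed
  have "(g \<longlongrightarrow> g t) (at t within {a..b})" if t: "t \<in> {a..b}" for t
  proof -
    have "((\<lambda>s. g s - g t) \<longlongrightarrow> 0) (at t within {a..b})"
    proof (rule Lim_null_comparison)
      show "\<forall>\<^sub>F s in at t within {a..b}. norm (g s - g t) \<le> norm (D s - D t) + norm (c s - c t) * (N / m)"
        unfolding eventually_at_filter
        by (rule eventuallyI) (use le t in \<open>fastforce simp: abs_le_iff norm_minus_commute\<close>)
      have "((\<lambda>s. norm (D s - D t) + norm (c s - c t) * (N / m)) \<longlongrightarrow>
          norm (D t - D t) + norm (c t - c t) * (N / m)) (at t within {a..b})"
        using c D t by (intro tendsto_intros) (auto simp: continuous_on_def)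
      then show "((\<lambda>s. norm (D s - D t) + norm (c s - c t) * (N / m)) \<longlongrightarrow> 0) (at t within {a..b})"
        by simp
    qed
    then show ?thesis by (simp add: LIM_zero_iff)
  qed
  then show ?thesis unfolding g_def continuous_on_def by blast
qed

text \<open>
  Composing a lift with an orthogonal curve that cancels the vertical part of its velocity shows
  that the distance grows at most at the speed of the horizontal part.
\<close>

lemma align_dist_le_horizontal_length:
  fixes c D :: "real \<Rightarrow> real^'r^'p"
  assumes ab: "a \<le> b"
    and der: "\<And>t. t \<in> {a..b} \<Longrightarrow> (c has_vector_derivative D t) (at t)"
    and D: "continuous_on {a..b} D"
    and rk: "\<And>t. t \<in> {a..b} \<Longrightarrow> c t \<in> full_col_rank"
  shows "align_dist (c a) (c b) \<le> integral {a..b} (\<lambda>t. norm (horizontal_lift (c t) (D t)))"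
proof -
  have c: "continuous_on {a..b} c"
    by (rule continuous_on_vector_derivative) (use der has_vector_derivative_at_within in blast)
  define g where "g t = norm (horizontal_lift (c t) (D t))" for t
  have g: "continuous_on {a..b} g"
    unfolding g_def by (rule continuous_on_norm_horizontal_lift[OF c D rk])
  \<comment> \<open>The distance along the curve may fail to be differentiable, whence the one-sided
    criterion. Its error \<open>e\<close> is shared equally between the curve and the
    integral.\<close>
  define \<phi> where "\<phi> t = align_dist (c a) (c t) - integral {a..t} g" for t
  have "\<phi> b \<le> \<phi> a"
  proof (rule right_decrease_imp_le[OF ab])
    have "continuous_on {a..b} (\<lambda>t. align_dist (c a) (c t))"
      unfolding continuous_on_def
    proof
      fix t assume t: "t \<in> {a..b}"
      have "((\<lambda>s. align_dist (c a) (c s) - align_dist (c a) (c t)) \<longlongrightarrow> 0) (at t within {a..b})"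
      proof (rule Lim_null_comparison)
        show "\<forall>\<^sub>F s in at t within {a..b}. norm (align_dist (c a) (c s) - align_dist (c a) (c t)) \<le> norm (c s - c t)"
        proof (rule eventuallyI)
          fix s
          show "norm (align_dist (c a) (c s) - align_dist (c a) (c t)) \<le> norm (c s - c t)"
            using align_dist_triangle[of "c a" "c s" "c t"] align_dist_triangle[of "c a" "c t" "c s"]
              align_dist_commute[of "c s" "c t"] align_dist_le_norm[of "c t" "c s"] by simp
        qed
        have "((\<lambda>s. norm (c s - c t)) \<longlongrightarrow> norm (c t - c t)) (at t within {a..b})"
          using c t by (intro tendsto_intros) (auto simp: continuous_on_def)
        then show "((\<lambda>s. norm (c s - c t)) \<longlongrightarrow> 0) (at t within {a..b})" by simp
      qed
      then show "((\<lambda>t. align_dist (c a) (c t)) \<longlongrightarrow> align_dist (c a) (c t)) (at t within {a..b})"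
        by (simp add: LIM_zero_iff)
    qed
    then show "continuous_on {a..b} \<phi>"
      unfolding \<phi>_def
      by (intro continuous_intros indefinite_integral_continuous_1 integrable_continuous_real g)
  next
    fix t e :: real assume t: "a \<le> t" "t < b" and e: "0 < e"
    then have tab: "t \<in> {a..b}" by auto
    obtain W where W: "transpose W = - W" "D t = horizontal_lift (c t) (D t) + c t ** W"
      using horizontal_lift_obtain .
    have "transpose (- W) = - (- W)" using W by (simp add: transpose_arith)
    then obtain Q where Q: "\<And>h. orthogonal_matrix (Q h)" "Q 0 = mat 1"
        "(Q has_vector_derivative - W) (at 0)"
      using orthogonal_curve_exists by blast
    have "((\<lambda>s. c s) has_vector_derivative D t) (at t)" by (rule der[OF tab])
    moreover have "((\<lambda>s. s - t) has_vector_derivative 1) (at t)"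
      by (auto intro!: derivative_eq_intros)
    then have "(Q \<circ> (\<lambda>s. s - t) has_vector_derivative 1 *\<^sub>R (- W)) (at t)"
      by (rule vector_diff_chain_at) (simp add: Q)
    ultimately have "((\<lambda>s. c s ** Q (s - t)) has_vector_derivative
        c t ** (- W) + D t ** Q (t - t)) (at t)"
      by (intro has_vector_derivative_matrix_mult) (simp_all add: o_def)
    moreover have "c t ** (- W) + D t ** Q (t - t) = horizontal_lift (c t) (D t)"
      by (subst W(2)) (simp add: Q matrix_mult_distribs)
    ultimately have "((\<lambda>s. c s ** Q (s - t)) has_vector_derivative horizontal_lift (c t) (D t)) (at t)"
      by simp
    then have "\<exists>d>0. \<forall>s. norm (s - t) < d \<longrightarrow>
        norm (c s ** Q (s - t) - c t ** Q (t - t) - (s - t) *\<^sub>R horizontal_lift (c t) (D t))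
          \<le> e / 2 * norm (s - t)"
      using e half_gt_zero[OF e] unfolding has_vector_derivative_def has_derivative_at_alt by blast
    then obtain d1 where d1: "d1 > 0" "\<And>s. norm (s - t) < d1 \<Longrightarrow>
        norm (c s ** Q (s - t) - c t - (s - t) *\<^sub>R horizontal_lift (c t) (D t)) \<le> e / 2 * norm (s - t)"
      by (auto simp: Q)
    have "\<exists>d>0. \<forall>s\<in>{a..b}. norm (s - t) < d \<longrightarrow>
        norm (integral {a..s} g - integral {a..t} g - (s - t) *\<^sub>R g t) \<le> e / 2 * norm (s - t)"
      using integral_has_vector_derivative[OF g tab] half_gt_zero[OF e]
      unfolding has_vector_derivative_def has_derivative_within_alt by blast
    then obtain d2 where d2: "d2 > 0" "\<And>s. s \<in> {a..b} \<Longrightarrow> norm (s - t) < d2 \<Longrightarrow>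
        norm (integral {a..s} g - integral {a..t} g - (s - t) *\<^sub>R g t) \<le> e / 2 * norm (s - t)"
      by blast
    show "\<exists>d>0. \<forall>s. t < s \<longrightarrow> s < t + d \<longrightarrow> s \<le> b \<longrightarrow> \<phi> s \<le> \<phi> t + e * (s - t)"
    proof (intro exI[of _ "min d1 d2"] conjI allI impI)
      fix s assume s: "t < s" "s < t + min d1 d2" "s \<le> b"
      have "align_dist (c t) (c s) \<le> norm (c s ** Q (s - t) - c t)"
        by (rule align_dist_le[OF Q(1)])
      also have "\<dots> \<le> norm (c s ** Q (s - t) - c t - (s - t) *\<^sub>R horizontal_lift (c t) (D t))
          + norm ((s - t) *\<^sub>R horizontal_lift (c t) (D t))"
        by (metis diff_add_cancel norm_triangle_ineq)
      also have "\<dots> \<le> e / 2 * (s - t) + (s - t) * g t"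
        using d1(2)[of s] s by (simp add: g_def)
      finally have "align_dist (c t) (c s) \<le> e / 2 * (s - t) + (s - t) * g t" .
      moreover have "align_dist (c a) (c s) \<le> align_dist (c a) (c t) + align_dist (c t) (c s)"
        by (rule align_dist_triangle)
      moreover have "integral {a..s} g - integral {a..t} g \<ge> (s - t) * g t - e / 2 * (s - t)"
      proof -
        have "\<bar>integral {a..s} g - integral {a..t} g - (s - t) * g t\<bar> \<le> e / 2 * (s - t)"
          using d2(2)[of s] s t by simp
        then show ?thesis by linarith
      qed
      moreover have "e * (s - t) = e / 2 * (s - t) + e / 2 * (s - t)" by simp
      ultimately show "\<phi> s \<le> \<phi> t + e * (s - t)"
        unfolding \<phi>_def by linarith
    qed (use d1 d2 in auto)
  qed
  moreover have "align_dist (c a) (c a) \<le> 0"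
    using align_dist_le_norm[of "c a" "c a"] by simp
  ultimately show ?thesis
    unfolding \<phi>_def g_def by simp
qed

lemma C1_lift_derivative:
  assumes "C1_lift c \<gamma> a b" "t \<in> {a..b}"
  shows "(c has_vector_derivative vector_derivative c (at t)) (at t)"
  using assms by (simp add: C1_lift_def C1_differentiable_on_eq vector_derivative_works)

lemma geo_dist_le_curve_length:
  assumes "C1_curve \<gamma> a b" "a \<le> b"
  shows "geo_dist (\<gamma> a) (\<gamma> b) \<le> curve_length \<gamma> a b"
proof -
  define c where "c = (SOME c. C1_lift c \<gamma> a b)"
  have c: "C1_lift c \<gamma> a b"
    using assms(1) unfolding c_def C1_curve_def by (rule someI_ex)
  have "align_dist (c a) (c b) \<le>
      integral {a..b} (\<lambda>t. norm (horizontal_lift (c t) (vector_derivative c (at t))))"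
    using c by (intro align_dist_le_horizontal_length assms(2) C1_lift_derivative[OF c])
      (auto simp: C1_lift_def C1_differentiable_on_eq)
  moreover have "\<gamma> a = orbit_class (c a)" "\<gamma> b = orbit_class (c b)"
    using c assms(2) by (auto simp: C1_lift_def)
  ultimately show ?thesis
    by (simp add: curve_length_def Let_def sqrt_quot_metric geo_dist_orbit_class flip: c_def)
qed

lemma curve_length_eq:
  assumes c: "C1_lift c \<gamma> a b"
  shows "curve_length \<gamma> a b =
    integral {a..b} (\<lambda>t. norm (horizontal_lift (c t) (vector_derivative c (at t))))"
proof -
  define c' where "c' = (SOME c. C1_lift c \<gamma> a b)"
  have c': "C1_lift c' \<gamma> a b"
    using someI[of "\<lambda>c. C1_lift c \<gamma> a b", OF c] by (simp add: c'_def)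
  \<comment> \<open>The comparison of two lifts needs an open set on which their classes agree, so
    the two end points are discarded as a null set.\<close>
  have "integral {a..b} (\<lambda>t. norm (horizontal_lift (c' t) (vector_derivative c' (at t)))) =
      integral {a..b} (\<lambda>t. norm (horizontal_lift (c t) (vector_derivative c (at t))))"
  proof (rule integral_spike[of "{a, b}"])
    fix t assume t: "t \<in> {a..b} - {a, b}"
    show "norm (horizontal_lift (c t) (vector_derivative c (at t))) =
        norm (horizontal_lift (c' t) (vector_derivative c' (at t)))"
    proof (rule norm_horizontal_lift_lift_indep)
      show "(c has_vector_derivative vector_derivative c (at t)) (at t)"
        "(c' has_vector_derivative vector_derivative c' (at t)) (at t)"
        using C1_lift_derivative c c' t by blast+
      show "open {a<..<b}" "t \<in> {a<..<b}" "c' t \<in> full_col_rank"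
        using t c' by (auto simp: C1_lift_def)
      show "orbit_class (c s) = orbit_class (c' s)" if "s \<in> {a<..<b}" for s
        using that c c' unfolding C1_lift_def
        by (metis atLeastAtMost_iff greaterThanLessThan_iff less_imp_le)
    qed
  qed auto
  then show ?thesis
    by (simp add: curve_length_def Let_def sqrt_quot_metric flip: c'_def)
qed

subsection \<open>The least singular value\<close>

lemma linear_quadratic_nonneg_imp_zero:
  fixes a b :: real
  assumes "\<And>h. 0 \<le> a * h + b * h\<^sup>2"
  shows "a = 0"
proof (rule ccontr)
  assume "a \<noteq> 0"
  \<comment> \<open>This \<open>h\<close> has the sign opposite to \<open>a\<close> and is small
    enough that the quadratic term cannot make up for the linear one.\<close>
  have 1: "0 \<le> a * (- a / (\<bar>b\<bar> + 1)) + b * (- a / (\<bar>b\<bar> + 1))\<^sup>2"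
    by (rule assms)
  have "a * (- a / (\<bar>b\<bar> + 1)) + b * (- a / (\<bar>b\<bar> + 1))\<^sup>2 = (a\<^sup>2 / (\<bar>b\<bar> + 1)\<^sup>2) * (b - (\<bar>b\<bar> + 1))"
    by (simp add: divide_simps power2_eq_square) (simp add: algebra_simps)
  moreover have "(a\<^sup>2 / (\<bar>b\<bar> + 1)\<^sup>2) * (b - (\<bar>b\<bar> + 1)) < 0"
    using \<open>a \<noteq> 0\<close> by (intro mult_pos_neg) (auto simp: add_nonneg_eq_0_iff)
  ultimately show False using 1 by linarith
qed

text \<open>Invariance of \<open>U\<close> makes the residual \<open>r\<close> of the eigenvalue
  equation an admissible direction, and the first-order condition in that direction reads
  \<open>r \<bullet> r = 0\<close>. Allowing a subspace serves both the whole space and the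
  complement of the eigenspaces.\<close>

lemma rayleigh_minimizer:
  fixes Y :: "real^'r^'p"
  assumes U: "subspace U" "U \<noteq> {0}"
    and inv: "\<And>u. u \<in> U \<Longrightarrow> (transpose Y ** Y) *v u \<in> U"
  obtains u where "u \<in> U" "norm u = 1" "u \<in> gram_eigenspace Y (norm (Y *v u))"
    "\<And>w. w \<in> U \<Longrightarrow> norm (Y *v u) * norm w \<le> norm (Y *v w)"
proof -
  have "compact (U \<inter> sphere 0 1)"
    by (intro closed_Int_compact closed_subspace U) auto
  moreover obtain u0 where "u0 \<in> U" "u0 \<noteq> 0"
    using U subspace_0 by blast
  then have "inverse (norm u0) *\<^sub>R u0 \<in> U \<inter> sphere 0 1"
    using U by (simp add: subspace_scale)
  then have "U \<inter> sphere 0 1 \<noteq> {}" by blast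
  moreover have "continuous_on (U \<inter> sphere 0 1) (\<lambda>v. norm (Y *v v))"
    by (intro continuous_on_norm linear_continuous_on matrix_vector_mul_bounded_linear)
  ultimately obtain u where u': "u \<in> U \<inter> sphere 0 1"
      "\<forall>v\<in>U \<inter> sphere 0 1. norm (Y *v u) \<le> norm (Y *v v)"
    using continuous_attains_inf[of "U \<inter> sphere 0 1" "\<lambda>v. norm (Y *v v)"] by metis
  have u: "u \<in> U" "norm u = 1" "\<And>v. v \<in> U \<Longrightarrow> norm v = 1 \<Longrightarrow> norm (Y *v u) \<le> norm (Y *v v)"
    using u' by simp_all
  define m where "m = norm (Y *v u)"
  have low: "m * norm w \<le> norm (Y *v w)" if "w \<in> U" for w
  proof (cases "w = 0")
    case False
    have "m \<le> norm (Y *v (inverse (norm w) *\<^sub>R w))"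
      using u(3)[of "inverse (norm w) *\<^sub>R w"] False that U by (simp add: m_def subspace_scale)
    also have "\<dots> = norm (Y *v w) / norm w"
      by (simp add: matrix_vector_mult_scaleR divide_inverse mult.commute)
    finally show ?thesis using False by (simp add: field_simps)
  qed simp
  define r where "r = (transpose Y ** Y) *v u - m\<^sup>2 *\<^sub>R u"
  have rU: "r \<in> U"
    unfolding r_def by (intro subspace_diff subspace_scale inv u U)
  have "0 \<le> (2 * (r \<bullet> r)) * h + ((norm (Y *v r))\<^sup>2 - m\<^sup>2 * (norm r)\<^sup>2) * h\<^sup>2" for h
  proof -
    have "u + h *\<^sub>R r \<in> U"
      by (intro subspace_add subspace_scale rU u U)
    then have "(m * norm (u + h *\<^sub>R r))\<^sup>2 \<le> (norm (Y *v (u + h *\<^sub>R r)))\<^sup>2"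
      by (intro power_mono low) (auto simp: m_def)
    moreover have "(Y *v u) \<bullet> (Y *v r) = r \<bullet> r + m\<^sup>2 * (u \<bullet> r)"
    proof -
      have "(Y *v u) \<bullet> (Y *v r) = ((transpose Y ** Y) *v u) \<bullet> r"
        by (metis inner_commute inner_matrix_vector matrix_vector_mul_assoc)
      also have "(transpose Y ** Y) *v u = r + m\<^sup>2 *\<^sub>R u" by (simp add: r_def)
      finally show ?thesis by (simp add: inner_add_left)
    qed
    moreover have "(norm (Y *v (u + h *\<^sub>R r)))\<^sup>2 =
        m\<^sup>2 + 2 * h * ((Y *v u) \<bullet> (Y *v r)) + h\<^sup>2 * (norm (Y *v r))\<^sup>2"
      unfolding m_def matrix_vector_right_distrib matrix_vector_mult_scaleR power2_norm_eq_inner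
      by (simp add: inner_add_left inner_add_right inner_commute power2_eq_square)
    moreover have "(norm (u + h *\<^sub>R r))\<^sup>2 = 1 + 2 * h * (u \<bullet> r) + h\<^sup>2 * (norm r)\<^sup>2"
      using u(2) unfolding norm_eq_1 power2_norm_eq_inner
      by (simp add: inner_add_left inner_add_right inner_commute power2_eq_square)
    ultimately show ?thesis
      by (simp add: power_mult_distrib algebra_simps)
  qed
  then have "2 * (r \<bullet> r) = 0"
    by (rule linear_quadratic_nonneg_imp_zero)
  then have "u \<in> gram_eigenspace Y m"
    by (simp add: gram_eigenspace_def r_def)
  with u low that show thesis unfolding m_def by blast
qed

lemma subspace_gram_eigenspace: "subspace (gram_eigenspace Y s)"
  unfolding gram_eigenspace_def
  by (rule subspaceI) (auto simp: matrix_vector_right_distrib matrix_vector_mult_scaleR algebra_simps)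

lemma gram_eigenspace_orthogonal:
  assumes "v \<in> gram_eigenspace Y s" "w \<in> gram_eigenspace Y t" "0 \<le> s" "0 \<le> t" "s \<noteq> t"
  shows "v \<bullet> w = 0"
proof -
  have "((transpose Y ** Y) *v v) \<bullet> w = v \<bullet> ((transpose Y ** Y) *v w)"
    by (simp add: inner_matrix_vector matrix_transpose_mul)
  then have "s\<^sup>2 * (v \<bullet> w) = t\<^sup>2 * (v \<bullet> w)"
    using assms by (simp add: gram_eigenspace_def)
  moreover have "s\<^sup>2 \<noteq> t\<^sup>2" using assms by (simp add: power2_eq_iff_nonneg)
  ultimately show ?thesis by simp
qed

section \<open>The singular values, counted with multiplicity\<close>

context
  fixes Y :: "real^'r^'p" and P :: "real set"
  defines "P \<equiv> {s. 0 \<le> s \<and> gram_eigenspace Y s \<noteq> {0}}"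
begin

lemma dim_Union_gram_eigenspace:
  assumes "finite F" "F \<subseteq> P"
  shows "dim (\<Union>s\<in>F. gram_eigenspace Y s) = (\<Sum>s\<in>F. dim (gram_eigenspace Y s))"
  using assms
proof (induction F)
  case (insert s F)
  have "dim (gram_eigenspace Y s \<union> (\<Union>t\<in>F. gram_eigenspace Y t)) =
      dim (gram_eigenspace Y s) + dim (\<Union>t\<in>F. gram_eigenspace Y t)"
  proof (rule dim_orthogonal_sum)
    fix v w assume "v \<in> gram_eigenspace Y s" "w \<in> (\<Union>t\<in>F. gram_eigenspace Y t)"
    then obtain t where "t \<in> F" "w \<in> gram_eigenspace Y t" "v \<in> gram_eigenspace Y s" by blast
    moreover have "s \<noteq> t" using \<open>t \<in> F\<close> insert by blast
    ultimately show "v \<bullet> w = 0"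
      using insert.prems by (intro gram_eigenspace_orthogonal[of v Y s w t]) (auto simp: P_def)
  qed
  with insert show ?case by simp
qed simp

lemma dim_gram_eigenspace_pos:
  assumes "s \<in> P"
  shows "1 \<le> dim (gram_eigenspace Y s)"
proof -
  have "gram_eigenspace Y s \<noteq> {0}" "0 \<in> gram_eigenspace Y s"
    using assms subspace_0[OF subspace_gram_eigenspace] by (auto simp: P_def)
  then have "\<not> gram_eigenspace Y s \<subseteq> {0}" by blast
  then show ?thesis by (simp add: Suc_le_eq flip: dim_eq_0)
qed

text \<open>Too many nonzero, mutually orthogonal eigenspaces do not fit into the space. Finiteness
  matters because \<open>singular_values\<close> is a sum over \<open>P\<close>, and a sum over an
  infinite set defaults to the empty multiset.\<close>

lemma finite_singular_value_set: "finite P"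
proof (rule ccontr)
  assume "infinite P"
  then obtain F where F: "finite F" "card F = Suc CARD('r)" "F \<subseteq> P"
    using infinite_arbitrarily_large by blast
  have "card F \<le> (\<Sum>s\<in>F. dim (gram_eigenspace Y s))"
    using sum_mono[of F "\<lambda>_. 1" "\<lambda>s. dim (gram_eigenspace Y s)"] F(3) dim_gram_eigenspace_pos
    by (simp add: subset_iff del: dim_eq_0)
  also have "\<dots> = dim (\<Union>s\<in>F. gram_eigenspace Y s)"
    using F by (simp add: dim_Union_gram_eigenspace)
  also have "\<dots> \<le> CARD('r)"
    using dim_subset_UNIV[of "\<Union>s\<in>F. gram_eigenspace Y s"] by (simp only: DIM_cart DIM_real mult_1_right)
  finally show False using F(2) by simp
qed

text \<open>
  A minimizer of the Rayleigh quotient on the orthogonal complement of all eigenspaces would be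
  another eigenvector.
\<close>

lemma sum_dim_gram_eigenspace: "(\<Sum>s\<in>P. dim (gram_eigenspace Y s)) = CARD('r)"
proof -
  define V where "V = (\<Union>s\<in>P. gram_eigenspace Y s)"
  have "V\<^sup>\<bottom> = {0}"
  proof (rule ccontr)
    assume ne: "V\<^sup>\<bottom> \<noteq> {0}"
    have inv: "(transpose Y ** Y) *v u \<in> V\<^sup>\<bottom>" if u: "u \<in> V\<^sup>\<bottom>" for u
    proof -
      have "y \<bullet> ((transpose Y ** Y) *v u) = 0" if y: "y \<in> V" for y
      proof -
        obtain s where "y \<in> gram_eigenspace Y s" using y by (auto simp: V_def)
        then have "((transpose Y ** Y) *v y) \<bullet> u = s\<^sup>2 * (y \<bullet> u)"
          by (simp add: gram_eigenspace_def)
        also have "y \<bullet> u = 0" using u y by (simp add: orthogonal_comp_def orthogonal_def)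
        finally show ?thesis by (simp add: inner_matrix_vector matrix_transpose_mul)
      qed
      then show ?thesis by (simp add: orthogonal_comp_def orthogonal_def)
    qed
    obtain u where u: "u \<in> V\<^sup>\<bottom>" "norm u = 1" "u \<in> gram_eigenspace Y (norm (Y *v u))"
      using rayleigh_minimizer[OF subspace_orthogonal_comp ne inv] by blast
    then have "gram_eigenspace Y (norm (Y *v u)) \<noteq> {0}" by (metis norm_zero singletonD zero_neq_one)
    then have "norm (Y *v u) \<in> P" by (simp add: P_def)
    with u(3) have "u \<in> V" unfolding V_def by blast
    with u(1) have "u \<bullet> u = 0" by (simp add: orthogonal_comp_def orthogonal_def)
    with u(2) show False by simp
  qed
  have "span V = UNIV"
  proof (rule ccontr)
    assume "span V \<noteq> UNIV"
    then have "span V \<subset> span UNIV" by auto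
    then obtain x where x: "x \<noteq> 0" "\<And>y. y \<in> span V \<Longrightarrow> orthogonal x y"
      using orthogonal_to_subspace_exists_gen[of V UNIV] by blast
    then have "x \<in> V\<^sup>\<bottom>"
      by (auto simp: orthogonal_comp_def orthogonal_commute span_base)
    with x \<open>V\<^sup>\<bottom> = {0}\<close> show False by simp
  qed
  then have "dim V = CARD('r)"
    using dim_span[of V] by simp
  then show ?thesis
    using dim_Union_gram_eigenspace[OF finite_singular_value_set] by (simp add: V_def)
qed

text \<open>This makes index \<open>CARD('r) - 1\<close> of the descending list its last one, so
  that \<open>sing_val CARD('r) Y\<close> is the smallest entry.\<close>

lemma size_singular_values: "size (singular_values Y) = CARD('r)"
proof -
  have "size (\<Sum>s\<in>F. replicate_mset (n s) s) = (\<Sum>s\<in>F. n s)" if "finite F"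
    for F :: "real set" and n
    using that by induction auto
  then show ?thesis
    using finite_singular_value_set sum_dim_gram_eigenspace
    by (simp add: singular_values_def flip: P_def)
qed

lemma singular_value_mem:
  assumes "s \<in> P"
  shows "s \<in># singular_values Y"
proof -
  have "singular_values Y = replicate_mset (dim (gram_eigenspace Y s)) s +
      (\<Sum>t\<in>P - {s}. replicate_mset (dim (gram_eigenspace Y t)) t)"
    unfolding singular_values_def P_def[symmetric]
    by (rule sum.remove[OF finite_singular_value_set assms])
  moreover have "s \<in># replicate_mset (dim (gram_eigenspace Y s)) s"
    using dim_gram_eigenspace_pos[OF assms] by (simp add: in_replicate_mset del: dim_eq_0)
  ultimately show ?thesis by (metis union_iff)
qed

text \<open>The least stretch of \<open>Y\<close> on the unit sphere is itself a singular value,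
  hence not below the smallest one. The remaining proof knows the least singular value only through
  this inequality.\<close>

lemma sing_val_last_le: "sing_val CARD('r) Y * norm v \<le> norm (Y *v v)"
proof -
  have "(UNIV :: (real^'r) set) \<noteq> {0}"
    using axis_eq_0_iff[of "undefined :: 'r" "1 :: real"] by auto
  from rayleigh_minimizer[OF subspace_UNIV this, of Y]
  obtain u where u: "norm u = 1" "u \<in> gram_eigenspace Y (norm (Y *v u))"
      "\<And>w. norm (Y *v u) * norm w \<le> norm (Y *v w)"
    by auto
  define L where "L = sorted_list_of_multiset (singular_values Y)"
  have len: "length L = CARD('r)"
    by (metis L_def mset_sorted_list_of_multiset size_mset size_singular_values)
  have "gram_eigenspace Y (norm (Y *v u)) \<noteq> {0}"
    using u(1,2) by (metis norm_zero singletonD zero_neq_one)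
  then have "norm (Y *v u) \<in> P" by (simp add: P_def)
  then have "norm (Y *v u) \<in> set L"
    using singular_value_mem by (simp add: L_def)
  then obtain i where i: "i < length L" "L ! i = norm (Y *v u)"
    by (auto simp: in_set_conv_nth)
  have "sing_val CARD('r) Y = rev L ! (length L - 1)"
    by (simp add: sing_val_def len flip: L_def)
  also have "\<dots> = L ! 0"
    using len i by (simp add: rev_nth)
  also have "\<dots> \<le> norm (Y *v u)"
    using sorted_nth_mono[of L 0 i] i by (simp add: L_def)
  finally show ?thesis
    using u(3)[of v] by (meson mult_right_mono norm_ge_zero order_trans)
qed

end

subsection \<open>Strict convexity of the squared distance\<close>

text \<open>Each row pair contributes a matrix of squared norm \<open>2 * ((e \<bullet> e) * (f
  \<bullet> f) - (e \<bullet> f)\<^sup>2)\<close>. The constant 2 matters: the 4 of the plain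
  triangle inequality would require \<open>e\<^sup>2 < \<sigma> * (\<sigma> - e)\<close>, which
  fails for \<open>e\<close> near \<open>2 * \<sigma> / 3\<close>.\<close>

lemma norm_skew_part_le:
  fixes E F :: "real^'r^'p"
  shows "(norm (transpose E ** F - transpose F ** E))\<^sup>2 \<le> 2 * (norm E)\<^sup>2 * (norm F)\<^sup>2"
proof -
  define M where "M k = (\<chi> i j. E $ k $ i * F $ k $ j - F $ k $ i * E $ k $ j)" for k
  have "transpose E ** F - transpose F ** E = (\<Sum>k\<in>UNIV. M k)"
    by (simp add: M_def vec_eq_iff matrix_matrix_mult_def transpose_def sum_subtractf)
  moreover have "norm (M k) \<le> sqrt 2 * (norm (E $ k) * norm (F $ k))" for k
  proof (rule power2_le_imp_le)
    define e f where "e = E $ k" and "f = F $ k"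
    have "(norm (M k))\<^sup>2 = (\<Sum>i\<in>UNIV. \<Sum>j\<in>UNIV. (e $ i * f $ j - f $ i * e $ j)\<^sup>2)"
      by (simp only: power2_norm_eq_inner) (simp add: M_def e_def f_def inner_vec_def power2_eq_square)
    also have "\<dots> = (\<Sum>i\<in>UNIV. \<Sum>j\<in>UNIV. (e $ i)\<^sup>2 * (f $ j)\<^sup>2)
        + (\<Sum>i\<in>UNIV. \<Sum>j\<in>UNIV. (f $ i)\<^sup>2 * (e $ j)\<^sup>2)
        - 2 * (\<Sum>i\<in>UNIV. \<Sum>j\<in>UNIV. (e $ i * f $ i) * (e $ j * f $ j))"
      by (simp add: power2_diff power_mult_distrib sum.distrib sum_subtractf sum_distrib_left algebra_simps)
    also have "(\<Sum>i\<in>UNIV. \<Sum>j\<in>UNIV. (e $ i)\<^sup>2 * (f $ j)\<^sup>2) = (e \<bullet> e) * (f \<bullet> f)"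
      by (simp add: inner_vec_def power2_eq_square sum_product)
    also have "(\<Sum>i\<in>UNIV. \<Sum>j\<in>UNIV. (f $ i)\<^sup>2 * (e $ j)\<^sup>2) = (f \<bullet> f) * (e \<bullet> e)"
      by (simp add: inner_vec_def power2_eq_square sum_product)
    also have "(\<Sum>i\<in>UNIV. \<Sum>j\<in>UNIV. (e $ i * f $ i) * (e $ j * f $ j)) = (e \<bullet> f)\<^sup>2"
      by (simp add: inner_vec_def power2_eq_square sum_product)
    also have "(e \<bullet> e) * (f \<bullet> f) + (f \<bullet> f) * (e \<bullet> e) - 2 * (e \<bullet> f)\<^sup>2 \<le> 2 * ((e \<bullet> e) * (f \<bullet> f))"
      by simp
    finally show "(norm (M k))\<^sup>2 \<le> (sqrt 2 * (norm (E $ k) * norm (F $ k)))\<^sup>2"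
      by (simp add: power_mult_distrib power2_norm_eq_inner e_def f_def)
  qed auto
  ultimately have "norm (transpose E ** F - transpose F ** E) \<le> (\<Sum>k\<in>UNIV. sqrt 2 * (norm (E $ k) * norm (F $ k)))"
    by (simp add: sum_norm_le)
  also have "\<dots> = sqrt 2 * (\<Sum>k\<in>UNIV. \<bar>norm (E $ k)\<bar> * \<bar>norm (F $ k)\<bar>)"
    by (simp add: sum_distrib_left)
  also have "\<dots> \<le> sqrt 2 * (norm E * norm F)"
    unfolding norm_vec_def[of E] norm_vec_def[of F] by (intro mult_left_mono L2_set_mult_ineq) auto
  finally have "(norm (transpose E ** F - transpose F ** E))\<^sup>2 \<le> (sqrt 2 * (norm E * norm F))\<^sup>2"
    by (rule power_mono) auto
  then show ?thesis by (simp add: power_mult_distrib)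
qed

text \<open>It turns the loss in the linear functional \<open>Q \<bullet> S\<close> into a quadratic
  form of the defect \<open>mat 1 - Q\<close>, exactly and for all orthogonal \<open>Q\<close>, not
  just near the identity.\<close>

lemma orthogonal_defect_identity:
  fixes Q S :: "real^'n^'n"
  assumes "orthogonal_matrix Q" "transpose S = S"
  shows "(mat 1 - Q) \<bullet> (S ** (mat 1 - Q)) = 2 * (mat 1 \<bullet> S - Q \<bullet> S)"
proof -
  have "Q \<bullet> (S ** Q) = S \<bullet> (mat 1 :: real^'n^'n)"
    using assms(1) by (metis inner_commute inner_matrix_mult_right orthogonal_matrix_def)
  moreover have "mat 1 \<bullet> (S ** Q) = S \<bullet> Q"
    using assms(2) by (metis inner_commute inner_matrix_mult_left inner_matrix_mult_right inner_transpose matrix_mul_lid)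
  ultimately show ?thesis
    by (simp add: matrix_mult_distribs inner_diff_left inner_diff_right inner_commute)
qed

text \<open>With \<open>B = A + (B - A)\<close>, Cauchy-Schwarz leaves
  \<open>norm (A *v v) * (norm (A *v v) - e * norm v)\<close>, and both factors have lower
  bounds.\<close>

lemma gram_lower_bound:
  fixes A B :: "real^'r^'p"
  assumes "0 \<le> m" "\<And>v. m * norm v \<le> norm (A *v v)" "norm (B - A) \<le> e" "e \<le> m"
  shows "m * (m - e) * (norm v)\<^sup>2 \<le> v \<bullet> ((transpose A ** B) *v v)"
proof -
  have "(A *v v) \<bullet> ((B - A) *v v) \<ge> - (norm (A *v v) * norm ((B - A) *v v))"
    using Cauchy_Schwarz_ineq2[of "A *v v" "(B - A) *v v"] by (simp add: abs_le_iff)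
  moreover have "norm ((B - A) *v v) \<le> e * norm v"
    using norm_matrix_vector_le[of "B - A" v] assms(3) by (meson mult_right_mono norm_ge_zero order_trans)
  then have "norm (A *v v) * norm ((B - A) *v v) \<le> norm (A *v v) * (e * norm v)"
    by (rule mult_left_mono) simp
  moreover have "v \<bullet> ((transpose A ** B) *v v) = (norm (A *v v))\<^sup>2 + (A *v v) \<bullet> ((B - A) *v v)"
    by (simp add: matrix_vector_mult_diff_rdistrib power2_norm_eq_inner inner_diff_right inner_matrix_vector
        flip: matrix_vector_mul_assoc)
  ultimately have "v \<bullet> ((transpose A ** B) *v v) \<ge> norm (A *v v) * (norm (A *v v) - e * norm v)"
    by (simp add: power2_eq_square right_diff_distrib)
  moreover have "(m * norm v) * ((m - e) * norm v) \<le> norm (A *v v) * (norm (A *v v) - e * norm v)"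
  proof (rule mult_mono)
    have "e * norm v \<le> m * norm v" using assms(4) by (rule mult_right_mono) simp
    then show "0 \<le> (m - e) * norm v" by (simp add: left_diff_distrib)
  qed (use assms(2)[of v] in \<open>simp_all add: left_diff_distrib\<close>)
  ultimately show ?thesis by (simp add: power2_eq_square mult_ac)
qed

text \<open>Since \<open>norm (B ** Q) = norm B\<close>, equal distances mean equal values of
  \<open>Q \<bullet> S\<close>; positive definiteness of \<open>S\<close> then forces the defect of
  \<open>Q\<close> to vanish.\<close>

lemma aligner_unique:
  fixes A B :: "real^'r^'p"
  assumes "align_dist A B = norm (B - A)" "0 < s"
    and "\<And>v. s * (norm v)\<^sup>2 \<le> v \<bullet> ((transpose A ** B) *v v)"
    and Q: "orthogonal_matrix Q" "norm (B ** Q - A) = norm (B - A)"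
  shows "Q = mat 1"
proof -
  define S where "S = transpose A ** B"
  have S: "transpose S = S"
    using aligned_symmetric[OF assms(1)] by (simp add: S_def matrix_transpose_mul)
  have sq: "(norm (X - A))\<^sup>2 = (norm X)\<^sup>2 + (norm A)\<^sup>2 - 2 * (X \<bullet> A)" for X
    by (simp add: power2_norm_eq_inner inner_diff_left inner_diff_right inner_commute)
  have 1: "(B ** Q) \<bullet> A = (B ** mat 1) \<bullet> A"
    using Q(2) sq[of "B ** Q"] sq[of B] norm_orthogonal_right[OF Q(1), of B] by simp
  have 2: "(B ** R) \<bullet> A = R \<bullet> S" for R
    using S by (simp add: inner_matrix_mult_left S_def matrix_transpose_mul)
  have "mat 1 \<bullet> S - Q \<bullet> S = 0" using 1 unfolding 2 by simp
  then have "s * (norm (mat 1 - Q))\<^sup>2 \<le> 0"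
    using inner_quadratic_lower[of s S "mat 1 - Q"] assms(3) orthogonal_defect_identity[OF Q(1) S]
    by (simp add: S_def)
  then have "norm (mat 1 - Q) = 0"
    using assms(2) by (simp add: mult_le_0_iff)
  then show ?thesis by simp
qed

text \<open>
  Along a horizontal line the squared distance to \<open>A\<close> minus a linear function has a strict local
  minimum.  The skew part of \<open>transpose A ** \<theta>\<close>, which could spoil this, is controlled because
  \<open>transpose Z ** \<theta>\<close> is symmetric and \<open>Z\<close> is close to \<open>A\<close>.
\<close>

lemma align_dist_strict_support:
  fixes A Z \<theta> :: "real^'r^'p"
  assumes e: "align_dist Z A = e" "norm (A - Z) = e"
    and sig: "0 < \<sigma>" "\<And>v. \<sigma> * norm v \<le> norm (A *v v)" "3 * e < 2 * \<sigma>"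
    and hor: "transpose Z ** \<theta> = transpose \<theta> ** Z" and "\<theta> \<noteq> 0"
  obtains h0 l where "0 < h0"
    "\<And>h. h \<noteq> 0 \<Longrightarrow> \<bar>h\<bar> < h0 \<Longrightarrow> (align_dist Z A)\<^sup>2 + h * l < (align_dist (Z + h *\<^sub>R \<theta>) A)\<^sup>2"
proof -
  define S where "S = transpose A ** Z"
  define B where "B = transpose A ** \<theta>"
  define I where "I = (mat 1 :: real^'r^'r)"
  define s where "s = \<sigma> * (\<sigma> - e)"
  have "0 \<le> e" using e(2) by auto
  have S: "transpose S = S"
    using aligned_symmetric[of Z A] e by (simp add: S_def matrix_transpose_mul)
  have "norm (Z - A) \<le> e" using e by (simp add: norm_minus_commute)
  then have low: "s * (norm v)\<^sup>2 \<le> v \<bullet> (S *v v)" for v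
    unfolding s_def S_def using sig by (intro gram_lower_bound) auto
  \<comment> \<open>At the extreme \<open>e = 2 * \<sigma> / 3\<close> the two sides are
    \<open>2 * \<sigma>\<^sup>2 / 9\<close> and \<open>\<sigma>\<^sup>2 / 3\<close>.\<close>
  have s: "e\<^sup>2 / 2 < s"
  proof -
    have "(3 * e)\<^sup>2 \<le> (2 * \<sigma>)\<^sup>2" using sig \<open>0 \<le> e\<close> by (intro power_mono) auto
    moreover have "\<sigma> * (3 * e) < \<sigma> * (2 * \<sigma>)" using sig by simp
    moreover have "0 < \<sigma>\<^sup>2" using sig(1) by simp
    moreover have "s = \<sigma>\<^sup>2 - \<sigma> * e" by (simp add: s_def power2_eq_square right_diff_distrib)
    ultimately show ?thesis by (simp add: power_mult_distrib power2_eq_square)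
  qed
  define \<beta> where "\<beta> = norm (B - transpose B)"
  have \<beta>: "\<beta>\<^sup>2 \<le> 2 * e\<^sup>2 * (norm \<theta>)\<^sup>2"
  proof -
    have "B - transpose B = transpose (A - Z) ** \<theta> - transpose \<theta> ** (A - Z)"
      using hor by (simp add: B_def matrix_transpose_mul transpose_arith matrix_mult_distribs)
    then show ?thesis unfolding \<beta>_def using norm_skew_part_le[of "A - Z" \<theta>] e(2) by simp
  qed
  \<comment> \<open>For \<open>\<bar>h\<bar> < h0\<close> the second-order error
    \<open>\<bar>h\<bar> * norm B\<close> cannot use up the gap between \<open>s\<close> and
    \<open>e\<^sup>2 / 2\<close>.\<close>
  define h0 where "h0 = (s - e\<^sup>2 / 2) / (norm B + 1)"
  have h0: "0 < h0"
    using s unfolding h0_def by (intro divide_pos_pos) (auto simp: add_nonneg_pos)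
  \<comment> \<open>The slope at \<open>h = 0\<close> of the squared distance with \<open>Q\<close>
    frozen at the identity.\<close>
  define l where "l = 2 * (Z \<bullet> \<theta> - I \<bullet> B)"
  have "(align_dist Z A)\<^sup>2 + h * l < (align_dist (Z + h *\<^sub>R \<theta>) A)\<^sup>2"
    if h: "h \<noteq> 0" "\<bar>h\<bar> < h0" for h
  proof -
    obtain Q where Q: "orthogonal_matrix Q"
        "align_dist (Z + h *\<^sub>R \<theta>) A = norm (A ** Q - (Z + h *\<^sub>R \<theta>))"
      by (rule align_dist_attained)
    define q where "q = norm (I - Q)"
    have sq: "(norm (A ** R - (Z + h *\<^sub>R \<theta>)))\<^sup>2 =
        (norm A)\<^sup>2 + (norm Z)\<^sup>2 + 2 * h * (Z \<bullet> \<theta>) + h\<^sup>2 * (norm \<theta>)\<^sup>2 - 2 * (R \<bullet> S) - 2 * h * (R \<bullet> B)"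
      if R: "orthogonal_matrix R" for R h
    proof -
      have "(A ** R) \<bullet> (A ** R) = A \<bullet> A"
        using norm_orthogonal_right[OF R, of A] by (simp add: norm_eq_sqrt_inner)
      moreover have "(A ** R) \<bullet> Z = R \<bullet> S" "(A ** R) \<bullet> \<theta> = R \<bullet> B"
        by (simp_all add: inner_matrix_mult_left S_def B_def)
      ultimately show ?thesis
        unfolding power2_norm_eq_inner
        by (simp add: inner_diff_left inner_diff_right inner_add_left inner_add_right
            inner_commute power2_eq_square algebra_simps)
    qed
    have eZ: "(align_dist Z A)\<^sup>2 = (norm A)\<^sup>2 + (norm Z)\<^sup>2 - 2 * (I \<bullet> S)"
      using sq[OF orthogonal_matrix_id, of 0] e by (simp add: I_def)
    have 1: "s * q\<^sup>2 \<le> 2 * (I \<bullet> S - Q \<bullet> S)"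
      using inner_quadratic_lower[of s S "I - Q"] low orthogonal_defect_identity[OF Q(1) S]
      by (simp add: q_def I_def)
    \<comment> \<open>The symmetric part of \<open>Q - I\<close> is \<open>- 1 / 2\<close> times
      \<open>transpose (I - Q) ** (I - Q)\<close>, of second order in \<open>q\<close>. Only the
      skew part is of first order, and it sees only the skew part of \<open>B\<close>.\<close>
    have 2: "2 * \<bar>(Q - I) \<bullet> B\<bar> \<le> \<beta> * q + norm B * q\<^sup>2"
    proof -
      have QQ: "Q + transpose Q = 2 *\<^sub>R I - transpose (I - Q) ** (I - Q)"
        using Q(1) by (simp add: I_def matrix_mult_distribs transpose_arith orthogonal_matrix_def scaleR_2 transpose_mat)
      have "(Q - transpose Q) \<bullet> B = Q \<bullet> (B - transpose B)"
        using inner_transpose[of Q "transpose B"] by (simp add: inner_diff_left inner_diff_right)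
      moreover have "I \<bullet> (B - transpose B) = 0"
        using inner_transpose[of I B] by (simp add: I_def inner_diff_right transpose_mat)
      ultimately have "(Q - transpose Q) \<bullet> B = (Q - I) \<bullet> (B - transpose B)"
        by (simp add: inner_diff_left)
      moreover have "2 * ((Q - I) \<bullet> B) = (Q - transpose Q) \<bullet> B + (Q + transpose Q) \<bullet> B - 2 * (I \<bullet> B)"
        by (simp add: inner_diff_left inner_add_left)
      ultimately have "2 * ((Q - I) \<bullet> B) = (Q - I) \<bullet> (B - transpose B) - (transpose (I - Q) ** (I - Q)) \<bullet> B"
        by (simp add: QQ inner_diff_left)
      moreover have "\<bar>(Q - I) \<bullet> (B - transpose B)\<bar> \<le> \<beta> * q"
        using Cauchy_Schwarz_ineq2[of "Q - I" "B - transpose B"]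
        by (simp add: \<beta>_def q_def norm_minus_commute mult.commute)
      moreover have "\<bar>(transpose (I - Q) ** (I - Q)) \<bullet> B\<bar> \<le> norm B * q\<^sup>2"
      proof -
        have "norm (transpose (I - Q) ** (I - Q)) \<le> q\<^sup>2"
          using norm_matrix_mult_le[of "transpose (I - Q)" "I - Q"]
          by (simp add: q_def norm_transpose power2_eq_square)
        then have "norm (transpose (I - Q) ** (I - Q)) * norm B \<le> q\<^sup>2 * norm B"
          by (rule mult_right_mono) simp
        with Cauchy_Schwarz_ineq2[of "transpose (I - Q) ** (I - Q)" B] show ?thesis
          by (simp add: mult.commute)
      qed
      ultimately show ?thesis by linarith
    qed
    define k where "k = \<bar>h\<bar>"
    define s' where "s' = s - k * norm B"
    have s': "e\<^sup>2 / 2 < s'"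
    proof -
      have "k * (norm B + 1) < s - e\<^sup>2 / 2"
        using h unfolding k_def h0_def by (simp add: pos_less_divide_eq add_nonneg_pos)
      then show ?thesis unfolding s'_def by (simp add: k_def algebra_simps)
    qed
    have "2 * h * ((Q - I) \<bullet> B) \<le> k * (\<beta> * q + norm B * q\<^sup>2)"
    proof -
      have "2 * h * ((Q - I) \<bullet> B) \<le> k * (2 * \<bar>(Q - I) \<bullet> B\<bar>)"
        using abs_ge_self[of "h * ((Q - I) \<bullet> B)"] by (simp add: k_def abs_mult)
      also have "\<dots> \<le> k * (\<beta> * q + norm B * q\<^sup>2)"
        using 2 by (rule mult_left_mono) (simp add: k_def)
      finally show ?thesis .
    qed
    \<comment> \<open>Completing the square in \<open>q\<close>: the quadratic has negative
      discriminant because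
      \<open>\<beta>\<^sup>2 < 4 * s' * (norm \<theta>)\<^sup>2\<close>.\<close>
    moreover have "k * (\<beta> * q + norm B * q\<^sup>2) < h\<^sup>2 * (norm \<theta>)\<^sup>2 + s * q\<^sup>2"
    proof -
      have "0 < s'" using s' zero_le_power2[of e] by linarith
      have "0 < k\<^sup>2" using h by (simp add: k_def)
      have "\<beta>\<^sup>2 < 4 * s' * (norm \<theta>)\<^sup>2"
      proof -
        have "e\<^sup>2 / 2 * (norm \<theta>)\<^sup>2 < s' * (norm \<theta>)\<^sup>2"
          using s' \<open>\<theta> \<noteq> 0\<close> by (intro mult_strict_right_mono) auto
        with \<beta> show ?thesis by simp
      qed
      then have "0 < k\<^sup>2 * (4 * s' * (norm \<theta>)\<^sup>2 - \<beta>\<^sup>2)"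
        using \<open>0 < k\<^sup>2\<close> by (intro mult_pos_pos) auto
      then have "0 < (2 * s' * q - k * \<beta>)\<^sup>2 + k\<^sup>2 * (4 * s' * (norm \<theta>)\<^sup>2 - \<beta>\<^sup>2)"
        by (rule add_nonneg_pos[OF zero_le_power2])
      also have "\<dots> = 4 * s' * (s' * q\<^sup>2 - k * \<beta> * q + k\<^sup>2 * (norm \<theta>)\<^sup>2)"
        by (simp add: power2_eq_square algebra_simps)
      finally have "0 < s' * q\<^sup>2 - k * \<beta> * q + k\<^sup>2 * (norm \<theta>)\<^sup>2"
        using \<open>0 < s'\<close> by (simp add: zero_less_mult_iff)
      then show ?thesis by (simp add: s'_def k_def algebra_simps)
    qed
    ultimately show ?thesis
      using 1 sq[OF Q(1), of h] unfolding Q(2) eZ l_def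
      by (simp add: inner_diff_left algebra_simps)
  qed
  with h0 show thesis by (rule that)
qed

subsection \<open>Segments between aligned representatives\<close>

definition segment_curve :: "real^'r^'p \<Rightarrow> real^'r^'p \<Rightarrow> real \<Rightarrow> real^'r^'p" where
  "segment_curve A B t = A + t *\<^sub>R (B - A)"

lemma norm_segment_curve_diff: "norm (segment_curve A B s - segment_curve A B t) = \<bar>s - t\<bar> * norm (B - A)"
proof -
  have "segment_curve A B s - segment_curve A B t = (s - t) *\<^sub>R (B - A)"
    by (simp add: segment_curve_def scaleR_left_diff_distrib)
  then show ?thesis by simp
qed

lemma segment_curve_symmetric:
  fixes A B :: "real^'r^'p"
  assumes "align_dist A B = norm (B - A)"
  shows "transpose (segment_curve A B t) ** (B - A) = transpose (B - A) ** segment_curve A B t"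
proof -
  define X where "X = transpose A ** B"
  have "transpose A ** B = X" "transpose B ** A = X"
    using aligned_symmetric[OF assms] by (simp_all add: X_def)
  then show ?thesis
    by (simp add: segment_curve_def matrix_mult_distribs transpose_arith algebra_simps)
qed

text \<open>The three pieces of the segment bound their distances from above and add up to the
  distance of the ends, so none of the bounds can be strict.\<close>

lemma align_dist_segment_curve:
  fixes A B :: "real^'r^'p"
  assumes al: "align_dist A B = norm (B - A)" and st: "0 \<le> s" "s \<le> t" "t \<le> 1"
  shows "align_dist (segment_curve A B s) (segment_curve A B t) = (t - s) * norm (B - A)"
proof -
  have le: "align_dist (segment_curve A B s) (segment_curve A B t) \<le> (t - s) * norm (B - A)"
    if "s \<le> t" for s t
    using align_dist_le_norm[of "segment_curve A B s" "segment_curve A B t"] that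
    by (simp add: norm_segment_curve_diff)
  have "norm (B - A) = align_dist (segment_curve A B 0) (segment_curve A B 1)"
    by (simp add: segment_curve_def al)
  also have "\<dots> \<le> align_dist (segment_curve A B 0) (segment_curve A B s)
      + align_dist (segment_curve A B s) (segment_curve A B t)
      + align_dist (segment_curve A B t) (segment_curve A B 1)"
    using align_dist_triangle by (smt (verit, ccfv_SIG))
  finally show ?thesis
    using le[of 0 s] le[of s t] le[of t 1] st by (simp add: algebra_simps)
qed

text \<open>The velocity \<open>B - A\<close> is horizontal all along the segment, so every subarc
  has its Euclidean length. That length equals the distance of its end points, a lower bound for all
  competing curves.\<close>

lemma
  fixes A B :: "real^'r^'p"
  assumes al: "align_dist A B = norm (B - A)"
    and rk: "\<And>t. t \<in> {0..1} \<Longrightarrow> segment_curve A B t \<in> full_col_rank"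
  shows C1_lift_segment_curve:
      "0 \<le> a \<Longrightarrow> b \<le> 1 \<Longrightarrow> C1_lift (segment_curve A B) (\<lambda>t. orbit_class (segment_curve A B t)) a b"
    and curve_length_segment_curve: "0 \<le> a \<Longrightarrow> a \<le> b \<Longrightarrow> b \<le> 1 \<Longrightarrow>
      curve_length (\<lambda>t. orbit_class (segment_curve A B t)) a b = norm (B - A) * (b - a)"
    and shortest_geodesic_segment_curve: "shortest_geodesic (\<lambda>t. orbit_class (segment_curve A B t)) (orbit_class A) (orbit_class B)"
proof -
  let ?c = "segment_curve A B" and ?\<gamma> = "\<lambda>t. orbit_class (segment_curve A B t)"
  have der: "(?c has_vector_derivative (B - A)) (at t)" for t
    unfolding segment_curve_def by (auto intro!: derivative_eq_intros)
  show lift: "C1_lift ?c ?\<gamma> a b" if "0 \<le> a" "b \<le> 1" for a b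
    using that rk der unfolding C1_lift_def C1_differentiable_on_def by fastforce
  show len: "curve_length ?\<gamma> a b = norm (B - A) * (b - a)" if "0 \<le> a" "a \<le> b" "b \<le> 1" for a b
  proof -
    have "horizontal_lift (?c t) (vector_derivative ?c (at t)) = B - A" for t
    proof -
      have "vector_derivative ?c (at t) = B - A"
        by (rule vector_derivative_at[OF der])
      moreover have "B - A \<in> horizontal_space (?c t)"
        using segment_curve_symmetric[OF al, of t]
        by (simp add: horizontal_space_eq matrix_transpose_mul)
      ultimately show ?thesis by (simp add: horizontal_lift_horizontal)
    qed
    then show ?thesis
      using curve_length_eq[OF lift[of a b]] that by simp
  qed
  have min: "length_minimizing ?\<gamma> a b" if "0 \<le> a" "a \<le> b" "b \<le> 1" for a b
    unfolding length_minimizing_def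
  proof (intro allI impI)
    fix \<eta> assume \<eta>: "C1_curve \<eta> a b" "\<eta> a = ?\<gamma> a" "\<eta> b = ?\<gamma> b"
    have "curve_length ?\<gamma> a b = geo_dist (\<eta> a) (\<eta> b)"
      using that \<eta> by (simp add: len geo_dist_orbit_class align_dist_segment_curve[OF al])
    also have "\<dots> \<le> curve_length \<eta> a b"
      by (rule geo_dist_le_curve_length[OF \<eta>(1) that(2)])
    finally show "curve_length ?\<gamma> a b \<le> curve_length \<eta> a b" .
  qed
  have "C1_curve ?\<gamma> 0 1" unfolding C1_curve_def using lift[of 0 1] by auto
  moreover have "constant_speed ?\<gamma>"
    unfolding constant_speed_def using len by blast
  moreover have "\<exists>e>0. \<forall>a b. a \<in> {0..1} \<inter> ball t e \<longrightarrow> b \<in> {0..1} \<inter> ball t e \<longrightarrow> a \<le> b \<longrightarrow> length_minimizing ?\<gamma> a b" for t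
    using min by (intro exI[of _ 1]) auto
  ultimately show "shortest_geodesic ?\<gamma> (orbit_class A) (orbit_class B)"
    unfolding shortest_geodesic_def geodesic_joining_def geodesic_def
    using min[of 0 1] by (simp add: segment_curve_def)
qed

text \<open>Constant speed divides the length of \<open>\<eta>\<close> in the ratio of
  \<open>t\<close> to \<open>1 - t\<close>, and each arc bounds a distance. The curve
  \<open>\<gamma>\<close> supplies a known total length.\<close>

lemma shortest_geodesic_geo_dist:
  assumes "shortest_geodesic \<eta> P1 P2" "shortest_geodesic \<gamma> P1 P2" "t \<in> {0..1}"
  shows "geo_dist P1 (\<eta> t) \<le> t * curve_length \<gamma> 0 1" "geo_dist (\<eta> t) P2 \<le> (1 - t) * curve_length \<gamma> 0 1"
proof -
  have \<eta>: "C1_curve \<eta> 0 1" "\<eta> 0 = P1" "\<eta> 1 = P2"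
    using assms(1) by (auto simp: shortest_geodesic_def geodesic_joining_def geodesic_def)
  obtain v where v: "\<And>a b. 0 \<le> a \<Longrightarrow> a \<le> b \<Longrightarrow> b \<le> 1 \<Longrightarrow> curve_length \<eta> a b = v * (b - a)"
    using assms(1) by (auto simp: shortest_geodesic_def geodesic_joining_def geodesic_def constant_speed_def)
  have "v = curve_length \<eta> 0 1" using v[of 0 1] by simp
  also have "\<dots> \<le> curve_length \<gamma> 0 1"
    using assms(1,2) unfolding shortest_geodesic_def length_minimizing_def geodesic_joining_def geodesic_def by blast
  finally have vL: "v \<le> curve_length \<gamma> 0 1" .
  have sub: "C1_curve \<eta> a b" if "0 \<le> a" "b \<le> 1" for a b
  proof -
    obtain c D where c: "\<forall>t\<in>{0..1}. (c has_vector_derivative D t) (at t)" "continuous_on {0..1} D"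
        "\<forall>t\<in>{0..1}. c t \<in> full_col_rank \<and> \<eta> t = orbit_class (c t)"
      using \<eta>(1) unfolding C1_curve_def C1_lift_def C1_differentiable_on_def by blast
    have "{a..b} \<subseteq> {0..1}" using that by auto
    then have "C1_lift c \<eta> a b"
      using c continuous_on_subset unfolding C1_lift_def C1_differentiable_on_def by blast
    then show ?thesis unfolding C1_curve_def by blast
  qed
  have "geo_dist (\<eta> 0) (\<eta> t) \<le> curve_length \<eta> 0 t"
    using assms(3) by (intro geo_dist_le_curve_length sub) auto
  also have "\<dots> = t * v" using assms(3) v[of 0 t] by simp
  also have "\<dots> \<le> t * curve_length \<gamma> 0 1" using vL assms(3) by (intro mult_left_mono) auto
  finally show "geo_dist P1 (\<eta> t) \<le> t * curve_length \<gamma> 0 1" by (simp add: \<eta>)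
  have "geo_dist (\<eta> t) (\<eta> 1) \<le> curve_length \<eta> t 1"
    using assms(3) by (intro geo_dist_le_curve_length sub) auto
  also have "\<dots> = (1 - t) * v" using assms(3) v[of t 1] by simp
  also have "\<dots> \<le> (1 - t) * curve_length \<gamma> 0 1" using vL assms(3) by (intro mult_left_mono) auto
  finally show "geo_dist (\<eta> t) P2 \<le> (1 - t) * curve_length \<gamma> 0 1" by (simp add: \<eta>)
qed

text \<open>
  Points of a shortest geodesic realize equality in the triangle inequality for \<open>align_dist\<close>, so
  strict convexity of the norm puts aligned representatives on a straight segment, and the aligned
  end point is unique.
\<close>

lemma shortest_geodesic_unique:
  fixes A B :: "real^'r^'p"
  assumes al: "align_dist A B = norm (B - A)"
    and rk: "\<And>t. t \<in> {0..1} \<Longrightarrow> segment_curve A B t \<in> full_col_rank"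
    and m: "norm (B - A) < m" "\<And>v. m * norm v \<le> norm (A *v v)"
    and \<eta>: "shortest_geodesic \<eta> (orbit_class A) (orbit_class B)" and t: "t \<in> {0..1}"
  shows "\<eta> t = orbit_class (segment_curve A B t)"
proof -
  define L where "L = norm (B - A)"
  have "0 \<le> L" by (simp add: L_def)
  have len: "curve_length (\<lambda>t. orbit_class (segment_curve A B t)) 0 1 = L"
    using curve_length_segment_curve[OF al rk, of 0 1] by (simp add: L_def)
  obtain Z0 where Z0: "\<eta> t = orbit_class Z0"
    using \<eta> t by (auto simp: shortest_geodesic_def geodesic_joining_def geodesic_def C1_curve_def C1_lift_def)
  note d = shortest_geodesic_geo_dist[OF \<eta> shortest_geodesic_segment_curve[OF al rk] t, unfolded len Z0]
  obtain R where R: "orthogonal_matrix R" "align_dist A Z0 = norm (Z0 ** R - A)"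
    by (rule align_dist_attained)
  define Z where "Z = Z0 ** R"
  have Z: "\<eta> t = orbit_class Z" by (simp add: Z_def Z0 orbit_class_mult R)
  have dA: "norm (Z - A) \<le> t * L"
    using d(1) R by (simp add: geo_dist_orbit_class Z_def)
  obtain Q where Q: "orthogonal_matrix Q" "align_dist Z B = norm (B ** Q - Z)"
    by (rule align_dist_attained)
  have dB: "norm (B ** Q - Z) \<le> (1 - t) * L"
    using d(2) Q Z Z0 by (metis geo_dist_orbit_class)
  have tri: "norm (B ** Q - A) \<le> norm (Z - A) + norm (B ** Q - Z)"
    using norm_triangle_ineq[of "Z - A" "B ** Q - Z"] by simp
  \<comment> \<open>\<open>Q\<close> competes in the alignment of \<open>A\<close> with
    \<open>B\<close>; this closes the chain from \<open>L\<close> through the triangle inequality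
    back to \<open>t * L + (1 - t) * L\<close>, so equality holds throughout.\<close>
  have ge: "L \<le> norm (B ** Q - A)"
    using align_dist_le[OF Q(1), of A B] al by (simp add: L_def)
  have eqs: "norm (B ** Q - A) = L" "norm (Z - A) = t * L" "norm (B ** Q - Z) = (1 - t) * L"
    using tri ge dA dB by (simp_all add: algebra_simps)
  have "0 < m" using m(1) norm_ge_zero[of "B - A"] by linarith
  then have "m * (m - L) > 0" using m(1) by (simp add: L_def)
  moreover have "m * (m - L) * (norm v)\<^sup>2 \<le> v \<bullet> ((transpose A ** B) *v v)" for v
    using m \<open>0 < m\<close> by (intro gram_lower_bound) (auto simp: L_def)
  ultimately have "Q = mat 1"
    using aligner_unique[OF al _ _ Q(1)] eqs(1) L_def by blast
  then have BZ: "norm (B - Z) = (1 - t) * L" using eqs(3) by simp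
  have "norm ((Z - A) + (B - Z)) = norm (Z - A) + norm (B - Z)"
    using eqs(2) BZ by (simp add: L_def algebra_simps)
  then have par: "norm (Z - A) *\<^sub>R (B - Z) = norm (B - Z) *\<^sub>R (Z - A)"
    by (simp only: norm_triangle_eq)
  have "Z - A = t *\<^sub>R (B - A)"
  proof (cases "L = 0")
    case True
    then show ?thesis using eqs(2) by (simp add: L_def)
  next
    case False
    have "L *\<^sub>R (t *\<^sub>R (B - Z)) = L *\<^sub>R ((1 - t) *\<^sub>R (Z - A))"
      using par eqs(2) BZ by (simp add: mult.commute)
    then have "t *\<^sub>R (B - Z) = (1 - t) *\<^sub>R (Z - A)"
      using False by (simp only: scaleR_cancel_left) simp
    then show ?thesis by (simp add: algebra_simps)
  qed
  then have "Z = segment_curve A B t"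
    by (metis add.commute diff_add_cancel segment_curve_def)
  then show ?thesis by (simp add: Z)
qed

section \<open>Convexity of the ball\<close>

lemma align_dist_segment_curve_less:
  fixes A B Y :: "real^'r^'p"
  assumes al: "align_dist A B = norm (B - A)"
    and Y: "0 < \<sigma>" "\<And>v. \<sigma> * norm v \<le> norm (Y *v v)"
    and x: "align_dist A Y < x" "align_dist B Y < x" "x \<le> \<sigma> / 3"
    and t: "t \<in> {0..1}"
  shows "align_dist (segment_curve A B t) Y < x"
proof -
  define f where "f t = align_dist (segment_curve A B t) Y" for t
  define L where "L = norm (B - A)"
  have lip: "\<bar>f s - f t\<bar> \<le> \<bar>s - t\<bar> * L" for s t
  proof -
    have "f s \<le> \<bar>s - t\<bar> * L + f t" for s t
      using align_dist_triangle[of "segment_curve A B s" Y "segment_curve A B t"]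
        align_dist_le_norm[of "segment_curve A B s" "segment_curve A B t"]
        norm_segment_curve_diff[of A B t s]
      by (simp add: f_def L_def abs_minus_commute)
    from this[of s t] this[of t s] show ?thesis by (simp add: abs_le_iff abs_minus_commute)
  qed
  have "continuous_on {0..1} f"
    by (rule lipschitz_on_continuous_on[of L], rule lipschitz_onI)
      (use lip in \<open>auto simp: dist_real_def mult.commute L_def\<close>)
  then obtain t0 where t0: "t0 \<in> {0..1}" "\<And>s. s \<in> {0..1} \<Longrightarrow> f s \<le> f t0"
    using continuous_attains_sup[of "{0..1::real}" f] by auto
  have ends: "f 0 < x" "f 1 < x" using x by (simp_all add: f_def segment_curve_def)
  have "f t0 < x"
  proof (rule ccontr)
    assume ge: "\<not> f t0 < x"
    then have "t0 \<noteq> 0" "t0 \<noteq> 1" using ends by auto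
    then have in01: "0 < t0" "t0 < 1" using t0(1) by auto
    have "B - A \<noteq> 0"
      using lip[of t0 0] ge ends by (auto simp: L_def)
    \<comment> \<open>Replacing \<open>Y\<close> by \<open>Y ** Q\<close> aligns it with the point
      at \<open>t0\<close> and changes neither distances nor the lower bound
      \<open>\<sigma>\<close>.\<close>
    obtain Q where Q: "orthogonal_matrix Q" "f t0 = norm (Y ** Q - segment_curve A B t0)"
      unfolding f_def by (rule align_dist_attained)
    \<comment> \<open>Adding the two Lipschitz bounds from the ends gives
      \<open>2 * f t0 \<le> f 0 + f 1 + L < 4 * x\<close>, which is the origin of
      \<open>3 * f t0 < 2 * \<sigma>\<close>.\<close>
    have "L \<le> align_dist A Y + align_dist B Y"
      using align_dist_triangle[of A B Y] align_dist_commute[of B Y] al by (simp add: L_def)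
    moreover have "f t0 \<le> f 0 + t0 * L" "f t0 \<le> f 1 + (1 - t0) * L"
      using lip[of t0 0] lip[of t0 1] in01 by (auto simp: abs_le_iff)
    ultimately have "3 * f t0 < 2 * \<sigma>"
      using x by (simp add: f_def segment_curve_def algebra_simps)
    moreover have "\<sigma> * norm v \<le> norm ((Y ** Q) *v v)" for v
      using Y(2)[of "Q *v v"] Q(1) by (simp add: matrix_vector_mul_assoc norm_orthogonal_matrix_vector)
    ultimately obtain h0 l where h: "0 < h0"
        "\<And>h. h \<noteq> 0 \<Longrightarrow> \<bar>h\<bar> < h0 \<Longrightarrow> (align_dist (segment_curve A B t0) (Y ** Q))\<^sup>2 + h * l
          < (align_dist (segment_curve A B t0 + h *\<^sub>R (B - A)) (Y ** Q))\<^sup>2"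
      using align_dist_strict_support[of "segment_curve A B t0" "Y ** Q" "f t0" \<sigma> "B - A"]
        Q Y(1) segment_curve_symmetric[OF al, of t0] \<open>B - A \<noteq> 0\<close>
      by (auto simp: align_dist_mult_right f_def)
    have less: "(f t0)\<^sup>2 + h * l < (f (t0 + h))\<^sup>2" if "h \<noteq> 0" "\<bar>h\<bar> < h0" for h
      using h(2)[OF that] Q(1) by (simp add: align_dist_mult_right f_def segment_curve_def algebra_simps)
    \<comment> \<open>Both \<open>t0 + k\<close> and \<open>t0 - k\<close> stay in the unit
      interval; maximality at \<open>t0\<close> would force \<open>h * l < 0\<close> for
      \<open>h = k\<close> and for \<open>h = - k\<close>.\<close>
    define k where "k = Min {h0 / 2, t0, 1 - t0}"
    have k: "0 < k" "k < h0" "k \<le> t0" "k \<le> 1 - t0"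
      using h(1) in01 by (auto simp: k_def)
    have "(f s)\<^sup>2 \<le> (f t0)\<^sup>2" if "s \<in> {0..1}" for s
      using t0(2)[OF that] by (intro power_mono) (auto simp: f_def align_dist_nonneg)
    then have "(f (t0 + k))\<^sup>2 \<le> (f t0)\<^sup>2" "(f (t0 + - k))\<^sup>2 \<le> (f t0)\<^sup>2"
      using k in01 by auto
    with less[of k] less[of "- k"] k show False by simp
  qed
  with t0(2)[OF t] show ?thesis by (simp add: f_def)
qed

theorem theorem2:
  fixes Y :: "real^'r^'p" and x :: real
  assumes "CARD('r) \<le> CARD('p)"
    and "Y \<in> full_col_rank"
    and "0 < x" and "x \<le> sing_val CARD('r) Y / 3"
  shows "geodesically_convex (geo_ball x (orbit_class Y)) \<and>
    (\<forall>P1 \<in> geo_ball x (orbit_class Y). \<forall>P2 \<in> geo_ball x (orbit_class Y).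
       \<exists>\<gamma>. shortest_geodesic \<gamma> P1 P2 \<and> \<gamma> ` {0..1} \<subseteq> geo_ball x (orbit_class Y) \<and>
         (\<forall>\<eta>. shortest_geodesic \<eta> P1 P2 \<longrightarrow> (\<forall>t\<in>{0..1}. \<eta> t = \<gamma> t)))"
proof -
  define \<sigma> where "\<sigma> = sing_val CARD('r) Y"
  have \<sigma>: "0 < \<sigma>" "x \<le> \<sigma> / 3" using assms(3,4) by (auto simp: \<sigma>_def)
  have low: "\<sigma> * norm v \<le> norm (Y *v v)" for v
    unfolding \<sigma>_def by (rule sing_val_last_le)
  have main: "\<exists>\<gamma>. shortest_geodesic \<gamma> P1 P2 \<and> \<gamma> ` {0..1} \<subseteq> geo_ball x (orbit_class Y) \<and>
         (\<forall>\<eta>. shortest_geodesic \<eta> P1 P2 \<longrightarrow> (\<forall>t\<in>{0..1}. \<eta> t = \<gamma> t))"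
    if P: "P1 \<in> geo_ball x (orbit_class Y)" "P2 \<in> geo_ball x (orbit_class Y)" for P1 P2
  proof -
    obtain A B0 where A: "P1 = orbit_class A" and B0: "P2 = orbit_class B0"
      using P by (auto simp: geo_ball_def quot_manifold_def)
    obtain Q where Q: "orthogonal_matrix Q" "align_dist A B0 = norm (B0 ** Q - A)"
      by (rule align_dist_attained)
    define B where "B = B0 ** Q"
    have B: "P2 = orbit_class B" by (simp add: B_def B0 orbit_class_mult Q)
    have al: "align_dist A B = norm (B - A)"
      using Q by (simp add: B_def align_dist_mult_right)
    have dist: "align_dist A Y < x" "align_dist B Y < x"
      using P by (simp_all add: A B geo_ball_def geo_dist_orbit_class)
    \<comment> \<open>Passing from \<open>Y\<close> to a point of the ball costs at most a third of
      \<open>\<sigma>\<close>; two points of the ball are less than the remaining two thirds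
      apart.\<close>
    define m where "m = 2 * \<sigma> / 3"
    have L: "norm (B - A) < m"
      using align_dist_triangle[of A B Y] align_dist_commute[of B Y] al dist \<sigma>(2) by (simp add: m_def)
    have lowA: "m * norm v \<le> norm (A *v v)" for v
    proof -
      obtain R where R: "orthogonal_matrix R" "align_dist A Y = norm (Y ** R - A)"
        by (rule align_dist_attained)
      have "\<sigma> * norm v \<le> norm ((Y ** R) *v v)"
        using low[of "R *v v"] R(1) by (simp add: matrix_vector_mul_assoc norm_orthogonal_matrix_vector)
      also have "\<dots> \<le> norm (A *v v) + norm ((Y ** R - A) *v v)"
        using norm_triangle_ineq[of "A *v v" "(Y ** R - A) *v v"]
        by (simp add: matrix_vector_mult_diff_rdistrib)
      also have "norm ((Y ** R - A) *v v) \<le> \<sigma> / 3 * norm v"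
        using norm_matrix_vector_le[of "Y ** R - A" v] R(2) dist(1) \<sigma>(2)
        by (smt (verit) mult_right_mono norm_ge_zero)
      finally show ?thesis by (simp add: m_def)
    qed
    \<comment> \<open>The displacement from \<open>A\<close> stays below the least stretch of
      \<open>A\<close>, so no nonzero vector is annihilated along the segment.\<close>
    have rk: "segment_curve A B t \<in> full_col_rank" if t: "t \<in> {0..1}" for t
      unfolding full_col_rank_iff_inj
    proof (intro allI impI)
      fix v assume "segment_curve A B t *v v = 0"
      then have "A *v v = - ((t *\<^sub>R (B - A)) *v v)"
        by (simp add: segment_curve_def matrix_vector_mult_add_rdistrib eq_neg_iff_add_eq_0)
      then have "norm (A *v v) \<le> norm (t *\<^sub>R (B - A)) * norm v"
        using norm_matrix_vector_le[of "t *\<^sub>R (B - A)" v] by simp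
      also have "\<dots> \<le> norm (B - A) * norm v"
        using t by (intro mult_right_mono) (auto intro: mult_left_le_one_le)
      finally have "m * norm v \<le> norm (B - A) * norm v" using lowA[of v] by linarith
      with L show "v = 0" by (cases "v = 0") auto
    qed
    let ?\<gamma> = "\<lambda>t. orbit_class (segment_curve A B t)"
    have "shortest_geodesic ?\<gamma> P1 P2"
      using shortest_geodesic_segment_curve[OF al rk] by (simp add: A B)
    moreover have "?\<gamma> ` {0..1} \<subseteq> geo_ball x (orbit_class Y)"
      using rk align_dist_segment_curve_less[OF al \<sigma>(1) low dist \<sigma>(2)]
      by (auto simp: geo_ball_def quot_manifold_def geo_dist_orbit_class)
    moreover have "\<eta> t = ?\<gamma> t" if "shortest_geodesic \<eta> P1 P2" "t \<in> {0..1}" for \<eta> t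
      using shortest_geodesic_unique[OF al rk L lowA] that by (simp add: A B)
    ultimately show ?thesis by blast
  qed
  moreover have "geodesically_convex (geo_ball x (orbit_class Y))"
    using main unfolding geodesically_convex_def shortest_geodesic_def by meson
  ultimately show ?thesis by blast
qed

end
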